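(* Let $P_1,\dots,P_s\in\mathbb{C}[x_1,\dots,x_n]$ be nonzero polynomials. For ${\bf r}=(r_1,\dots,r_n)$ with $r_i\in\mathbb{Z}_{>0}$, put $P_{i,{\bf r}}(x)=P_i(x^{r_1},\dots,x^{r_n})$ and \[q({\bf r})=\min\Big\{\max_{1\le j\le n}|t_j| \;:\; {\bf t}=(t_1,\dots,t_n)\in\mathbb{Z}^n,\ {\bf t}\neq(0,\dots,0),\ \sum_{j=1}^n t_jr_j=0\Big\}.\] Then: \begin{enumerate} \item $\displaystyle\lim_{q({\bf r})\to\infty}\mathrm{m}_{\max}(P_{1,{\bf r}},\dots,P_{s,{\bf r}})=\mathrm{m}_{\max}(P_1,\dots,P_s)$; \item $\displaystyle\lim_{q({\bf r})\to\infty}\mathrm{m}(P_{1,{\bf r}},\dots,P_{s,{\bf r}})=\mathrm{m}(P_1,\dots,P_s)$; \item if $P_1=\dots=P_s=P$, then $\displaystyle\lim_{q({\bf r})\to\infty}\mathrm{m}_s(P_{\bf r})=\mathrm{m}_s(P)$. \end{enumerate} Here $\lim_{q({\bf r})\to\infty}a_{\bf r}=L$ means: for every $\varepsilon>0$ there is $Q$ such that $|a_{\bf r}-L|<\varepsilon$ for all ${\bf r}\in\mathbb{Z}_{>0}^n$ with $q({\bf r})\ge Q$.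
   Context: $\mathbb{T}^n=\{(z_1,\dots,z_n)\in\mathbb{C}^n: |z_1|=\dots=|z_n|=1\}$. For nonzero polynomials $P_1,\dots,P_s\in\mathbb{C}[x_1,\dots,x_n]$ (not necessarily distinct): the generalized Mahler measure is $\mathrm{m}_{\max}(P_1,\dots,P_s)=\frac{1}{(2\pi i)^n}\int_{\mathbb{T}^n}\max\{\log|P_1|,\dots,\log|P_s|\}\frac{dx_1}{x_1}\cdots\frac{dx_n}{x_n}$; the multiple Mahler measure is $\mathrm{m}(P_1,\dots,P_s)=\frac{1}{(2\pi i)^n}\int_{\mathbb{T}^n}\log|P_1|\cdots\log|P_s|\frac{dx_1}{x_1}\cdots\frac{dx_n}{x_n}$; the higher Mahler measure is $\mathrm{m}_s(P)=\frac{1}{(2\pi i)^n}\int_{\mathbb{T}^n}\log^s|P|\frac{dx_1}{x_1}\cdots\frac{dx_n}{x_n}$. (For univariate $P_{i,{\bf r}}$ these are the same definitions with $n=1$.) *)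

theory Defs
  imports "HOL-Analysis.Analysis" "HOL-Library.Poly_Mapping"
begin

text \<open>Polynomials in the variables \<open>x\<^sub>j\<close>, \<open>j :: 'n\<close>: finitely supported maps from exponent
  vectors to coefficients, with the convolution product of \<^theory>\<open>HOL-Library.Poly_Mapping\<close>.
  The dimension is \<open>CARD('n)\<close>; univariate polynomials are those over the one-element type \<open>1\<close>.\<close>

type_synonym 'n cpoly = "('n \<Rightarrow>\<^sub>0 nat) \<Rightarrow>\<^sub>0 complex"

definition cpoly_const :: "complex \<Rightarrow> 'n cpoly" where
  "cpoly_const c = Poly_Mapping.single 0 c"

definition cpoly_var :: "'n \<Rightarrow> 'n cpoly" where
  "cpoly_var j = Poly_Mapping.single (Poly_Mapping.single j 1) 1"

definition cpoly_eval :: "('n::finite) cpoly \<Rightarrow> complex ^ 'n \<Rightarrow> complex" where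
  "cpoly_eval P z =
     (\<Sum>m\<in>Poly_Mapping.keys P. Poly_Mapping.lookup P m * (\<Prod>j\<in>UNIV. (z $ j) ^ Poly_Mapping.lookup m j))"

definition power_subst :: "('n::finite \<Rightarrow> nat) \<Rightarrow> 'n cpoly \<Rightarrow> 1 cpoly" where
  "power_subst r P =
     (\<Sum>m\<in>Poly_Mapping.keys P. cpoly_const (Poly_Mapping.lookup P m) *
        (\<Prod>j\<in>UNIV. (cpoly_var 1 ^ r j) ^ Poly_Mapping.lookup m j))"

text \<open>The integral over the torus against \<open>dx\<^sub>1/x\<^sub>1 \<cdots> dx\<^sub>n/x\<^sub>n\<close>, divided by \<open>(2\<pi>i)\<^sup>n\<close>, in the
  parametrisation \<open>x\<^sub>j = exp(i\<theta>\<^sub>j)\<close>, for which \<open>dx\<^sub>j/x\<^sub>j = i d\<theta>\<^sub>j\<close>.\<close>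

definition torus_integral :: "(complex ^ ('n::finite) \<Rightarrow> real) \<Rightarrow> real" where
  "torus_integral f =
     1 / (2 * pi) ^ CARD('n) *
     (LINT \<theta>:cbox 0 (\<chi> j. 2 * pi)|lborel. f (\<chi> j. cis (\<theta> $ j)))"

text \<open>In the integrands below \<open>log 0\<close> has the library value \<open>0\<close> instead of \<open>-\<infinity>\<close>. For nonzero
  polynomials this only concerns a null subset of the torus. A polynomial \<open>power_subst r P\<close> with
  \<open>P \<noteq> 0\<close> can vanish identically, but only when \<open>q_rel r\<close> (below) is at most a bound depending on
  \<open>P\<close>, so such \<open>r\<close> play no role in the limit.\<close>

definition mahler_max :: "nat \<Rightarrow> (nat \<Rightarrow> ('n::finite) cpoly) \<Rightarrow> real" where
  "mahler_max s P = torus_integral (\<lambda>z. Max ((\<lambda>i. ln (norm (cpoly_eval (P i) z))) ` {1..s}))"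

definition mahler_multiple :: "nat \<Rightarrow> (nat \<Rightarrow> ('n::finite) cpoly) \<Rightarrow> real" where
  "mahler_multiple s P = torus_integral (\<lambda>z. \<Prod>i=1..s. ln (norm (cpoly_eval (P i) z)))"

definition mahler_higher :: "nat \<Rightarrow> ('n::finite) cpoly \<Rightarrow> real" where
  "mahler_higher s P = torus_integral (\<lambda>z. ln (norm (cpoly_eval P z)) ^ s)"

text \<open>The minimum is an infimum in \<open>enat\<close>: it is attained when there is a nontrivial relation
  \<open>t\<close>, and it is \<open>\<infinity>\<close> when there is none, which happens exactly in dimension one.\<close>

definition q_rel :: "('n::finite \<Rightarrow> nat) \<Rightarrow> enat" where
  "q_rel r = Inf {enat (nat (Max (range (\<lambda>j. \<bar>t j\<bar>)))) | t :: 'n \<Rightarrow> int.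
                    t \<noteq> (\<lambda>_. 0) \<and> (\<Sum>j\<in>UNIV. t j * int (r j)) = 0}"

text \<open>\<open>Q\<close> ranges over natural numbers: the filter \<open>at_top\<close> on \<open>enat\<close> is principal at \<open>\<infinity>\<close> and
  would not express this limit.\<close>

definition q_limit :: "(('n::finite \<Rightarrow> nat) \<Rightarrow> real) \<Rightarrow> real \<Rightarrow> bool" where
  "q_limit a L \<longleftrightarrow>
     (\<forall>\<epsilon>>0. \<exists>Q::nat. \<forall>r. (\<forall>j. r j > 0) \<and> q_rel r \<ge> enat Q \<longrightarrow> \<bar>a r - L\<bar> < \<epsilon>)"

lemma cpoly_eval_superset:
  assumes "finite A" "Poly_Mapping.keys P \<subseteq> A"
  shows "cpoly_eval P z =
    (\<Sum>m\<in>A. Poly_Mapping.lookup P m * (\<Prod>j\<in>UNIV. (z $ j) ^ Poly_Mapping.lookup m j))"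
  unfolding cpoly_eval_def
  by (rule sum.mono_neutral_left) (use assms in \<open>auto simp: in_keys_iff\<close>)

lemma cpoly_eval_add: "cpoly_eval (P + R) z = cpoly_eval P z + cpoly_eval R z"
proof -
  let ?A = "Poly_Mapping.keys P \<union> Poly_Mapping.keys R"
  have "finite ?A" "Poly_Mapping.keys (P + R) \<subseteq> ?A"
    by (auto dest: Poly_Mapping.keys_add[THEN subsetD])
  then show ?thesis
    by (simp add: cpoly_eval_superset[of ?A] lookup_add algebra_simps sum.distrib)
qed

lemma cpoly_eval_zero [simp]: "cpoly_eval 0 z = 0"
  by (simp add: cpoly_eval_def)

lemma cpoly_eval_sum: "cpoly_eval (\<Sum>i\<in>I. F i) z = (\<Sum>i\<in>I. cpoly_eval (F i) z)"
  by (induction I rule: infinite_finite_induct) (auto simp: cpoly_eval_add)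

lemma cpoly_eval_single:
  "cpoly_eval (Poly_Mapping.single m c) z = c * (\<Prod>j\<in>UNIV. (z $ j) ^ Poly_Mapping.lookup m j)"
  by (simp add: cpoly_eval_def)

lemma cpoly_var_power: "cpoly_var j ^ k = Poly_Mapping.single (Poly_Mapping.single j k) 1"
  by (induction k) (simp_all add: cpoly_var_def mult_single single_add[symmetric])

lemma prod_cpoly_var_power:
  "finite J \<Longrightarrow> (\<Prod>j\<in>J. cpoly_var i ^ e j) = Poly_Mapping.single (Poly_Mapping.single i (\<Sum>j\<in>J. e j)) 1"
  by (metis cpoly_var_power power_sum)

lemma cpoly_eval_power_subst:
  "cpoly_eval (power_subst r P) z = cpoly_eval P (\<chi> j. (z $ 1) ^ r j)"
proof -
  have "(UNIV :: 1 set) = {1}" by auto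
  then show ?thesis
    unfolding power_subst_def cpoly_eval_sum
    by (simp add: power_mult[symmetric] prod_cpoly_var_power cpoly_const_def mult_single
        cpoly_eval_single power_sum) (simp add: cpoly_eval_def power_mult[symmetric])
qed

end

theory Submission
  imports Defs "HOL-Probability.Probability_Measure" "HOL-Computational_Algebra.Polynomial"
begin

text \<open>The integral of \<open>F (P\<^sub>1, \<dots>, P\<^sub>s)\<close> after the substitution \<open>x\<^sub>j = x ^ r\<^sub>j\<close> is the integral over the
  closed curve \<open>x \<mapsto> (x ^ r\<^sub>1, \<dots>, x ^ r\<^sub>n)\<close> in the torus. As \<open>q(r)\<close> grows these curves equidistribute: a
  given trigonometric polynomial is integrated exactly once \<open>q(r)\<close> exceeds its degree, and the
  Stone-Weierstrass theorem extends this to continuous integrands. What remains is to control the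
  logarithmic singularities uniformly in \<open>r\<close>. For this one bounds the measure of
  \<open>{x. norm (P\<^sub>i (x ^ r)) \<le> y}\<close> by \<open>C * y powr \<delta>\<close>, where \<open>C\<close> and \<open>\<delta>\<close> depend only on the number of terms of
  \<open>P\<^sub>i\<close> and the modulus of one of its coefficients (a bound of Lawton type). Equidistribution carries
  the same bound over to the full torus. Hence truncating the logarithms at \<open>ln y\<close> changes all
  integrals by at most \<open>K * y powr \<eta>\<close>, and the truncated integrands are continuous.\<close>

section \<open>The uniform angle on the circle\<close>

text \<open>The degree of \<open>power_subst r P\<close> grows with \<open>r\<close>, so a bound
  through its degree or its zeros would not be uniform. What survives the substitution is the number
  of terms and the coefficients, provided that different monomials keep different frequencies. Two
  of them collide exactly when the difference of their exponent vectors is a relation among the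
  \<open>r j\<close>; so a lower bound on q(r) serves twice, for equidistribution and for excluding
  collisions. A power of \<open>y\<close> in the measure bound, rather than mere convergence to 0,
  makes a small negative power of the modulus integrable with a uniform bound, and such a power
  dominates every power of the logarithm. Passing the bound from the curves to the torus replaces an
  induction over the variables; it requires that curves with arbitrarily large q(r) exist. Maximum
  and product are treated together through a functional \<open>g\<close> of the vector of
  logarithms, of which mainly the growth bound \<open>(1 + L) ^ s\<close> matters.\<close>

lemma borel_measurable_cis [measurable (raw)]:
  "f \<in> borel_measurable M \<Longrightarrow> (\<lambda>x. cis (f x)) \<in> borel_measurable M"
  by (rule borel_measurable_continuous_on[where f=cis]) (auto intro: continuous_intros)

definition circle_angle :: "real measure" where
  "circle_angle = uniform_measure lborel {0..2 * pi}"

lemma prob_space_circle_angle: "prob_space circle_angle"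
  unfolding circle_angle_def by (rule prob_space_uniform_measure) auto

lemma space_circle_angle [simp]: "space circle_angle = UNIV"
  and sets_circle_angle [measurable_cong, simp]: "sets circle_angle = sets borel"
  by (simp_all add: circle_angle_def)

interpretation circle_angle: prob_space circle_angle
  by (rule prob_space_circle_angle)

lemma integral_uniform_measure:
  fixes f :: "'a \<Rightarrow> 'b::{banach, second_countable_topology}"
  assumes [measurable]: "f \<in> borel_measurable M" "A \<in> sets M"
    and A: "emeasure M A \<noteq> 0" "emeasure M A \<noteq> \<infinity>"
  shows "(\<integral>x. f x \<partial>uniform_measure M A) = (1 / measure M A) *\<^sub>R (\<integral>x. indicator A x *\<^sub>R f x \<partial>M)"
proof -
  have em1: "emeasure M A = ennreal (measure M A)"
    using A by (intro emeasure_eq_ennreal_measure) auto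
  then have "measure M A \<noteq> 0" using A by auto
  then have em2: "0 < measure M A" by (simp add: zero_less_measure_iff)
  have eq: "uniform_measure M A = density M (\<lambda>x. ennreal (indicator A x / measure M A))"
    unfolding uniform_measure_def em1
    by (intro density_cong) (use em2 in \<open>auto simp: divide_ennreal indicator_def simp flip: ennreal_1\<close>)
  show ?thesis
    unfolding eq using em2 by (subst integral_density) (auto simp flip: integral_scaleR_right)
qed

lemma integral_circle_angle:
  fixes f :: "real \<Rightarrow> 'a::{banach, second_countable_topology}"
  assumes "f \<in> borel_measurable borel"
  shows "(\<integral>x. f x \<partial>circle_angle) = (1 / (2 * pi)) *\<^sub>R (\<integral>x. indicator {0..2 * pi} x *\<^sub>R f x \<partial>lborel)"
  unfolding circle_angle_def using assms by (subst integral_uniform_measure) auto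

lemma integral_cis_circle_angle:
  "(\<integral>x. cis (of_int k * x) \<partial>circle_angle) = (if k = 0 then 1 else 0)"
proof (cases "k = 0")
  case True
  then show ?thesis using circle_angle.prob_space by simp
next
  case False
  define F where "F = (\<lambda>x::real. cis (of_int k * x) / (\<i> * of_int k))"
  have "(\<integral>x. indicator {0..2 * pi} x *\<^sub>R cis (of_int k * x) \<partial>lborel) = F (2 * pi) - F 0"
  proof (rule integral_FTC_Icc)
    show "(F has_vector_derivative cis (of_int k * x)) (at x within {0..2 * pi})" for x
    proof -
      have "((\<lambda>z. exp (\<i> * of_int k * z) / (\<i> * of_int k)) has_field_derivative
          exp (\<i> * of_int k * of_real x)) (at (of_real x))"
        by (rule derivative_eq_intros refl)+ (use False in auto)
      from has_vector_derivative_real_field[OF this] show ?thesis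
        unfolding F_def cis_conv_exp by (simp add: mult.assoc)
    qed
  qed (auto intro!: continuous_intros)
  also have "\<dots> = 0"
    using cis_multiple_2pi[of "of_int k"] by (simp add: F_def mult.commute mult.left_commute)
  finally show ?thesis using False
    by (subst integral_circle_angle) auto
qed

text \<open>Rotation invariance: the piece of the interval that is moved below 0 wraps around by
  periodicity. It turns pairs of points into a point and a difference \<open>h\<close>.\<close>

lemma nn_integral_circle_angle_shift:
  fixes f :: "real \<Rightarrow> ennreal"
  assumes [measurable]: "f \<in> borel_measurable borel"
    and per: "\<And>x. f (x + 2 * pi) = f x" and a: "0 \<le> a" "a \<le> 2 * pi"
  shows "(\<integral>\<^sup>+x. f (x - a) \<partial>circle_angle) = (\<integral>\<^sup>+x. f x \<partial>circle_angle)"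
proof -
  have shift: "(\<integral>\<^sup>+x. g (x + c) \<partial>lborel) = (\<integral>\<^sup>+x. g x \<partial>lborel)"
    if [measurable]: "g \<in> borel_measurable borel" for g :: "real \<Rightarrow> ennreal" and c
    using nn_integral_real_affine[of g 1 c] by (simp add: add.commute)
  have "(\<integral>\<^sup>+x. f (x - a) * indicator {0..2 * pi} x \<partial>lborel) =
        (\<integral>\<^sup>+x. f (x - a) * indicator {0..<a} x + f (x - a) * indicator {a..2 * pi} x \<partial>lborel)"
    by (intro nn_integral_cong) (use a in \<open>auto simp: indicator_def\<close>)
  also have "\<dots> = (\<integral>\<^sup>+x. f (x - a) * indicator {0..<a} x \<partial>lborel) +
                  (\<integral>\<^sup>+x. f (x - a) * indicator {a..2 * pi} x \<partial>lborel)"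
    by (intro nn_integral_add) auto
  also have "(\<integral>\<^sup>+x. f (x - a) * indicator {a..2 * pi} x \<partial>lborel) =
      (\<integral>\<^sup>+x. f x * indicator {0..2 * pi - a} x \<partial>lborel)"
    by (subst shift[of _ a, symmetric]) (auto intro!: nn_integral_cong simp: indicator_def)
  also have "(\<integral>\<^sup>+x. f (x - a) * indicator {0..<a} x \<partial>lborel) =
      (\<integral>\<^sup>+x. f x * indicator {2 * pi - a..<2 * pi} x \<partial>lborel)"
    by (subst shift[of _ "a - 2 * pi", symmetric])
       (use per[of "x - 2 * pi" for x] in \<open>auto intro!: nn_integral_cong simp: indicator_def\<close>)
  \<comment> \<open>The endpoints, a null set, are exchanged so that this piece and
    \<open>{0..2 * pi - a}\<close> are disjoint with union \<open>{0..2 * pi}\<close>.\<close>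
  also have "\<dots> = (\<integral>\<^sup>+x. f x * indicator {2 * pi - a<..2 * pi} x \<partial>lborel)"
  proof (intro nn_integral_cong_AE)
    have "AE x in lborel. x \<noteq> 2 * pi - a" "AE x in lborel. x \<noteq> 2 * pi"
      by (rule AE_lborel_singleton)+
    then show "AE x in lborel. f x * indicator {2 * pi - a..<2 * pi} x =
        f x * indicator {2 * pi - a<..2 * pi} x"
      by eventually_elim (auto simp: indicator_def)
  qed
  also have "\<dots> + (\<integral>\<^sup>+x. f x * indicator {0..2 * pi - a} x \<partial>lborel) =
     (\<integral>\<^sup>+x. f x * indicator {2 * pi - a<..2 * pi} x + f x * indicator {0..2 * pi - a} x \<partial>lborel)"
    by (intro nn_integral_add[symmetric]) auto
  also have "\<dots> = (\<integral>\<^sup>+x. f x * indicator {0..2 * pi} x \<partial>lborel)"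
    by (intro nn_integral_cong) (use a in \<open>auto simp: indicator_def\<close>)
  finally show ?thesis
    unfolding circle_angle_def by (simp add: nn_integral_uniform_measure)
qed

section \<open>Concentration of a character near 1\<close>

lemma norm_cis_mult_diff_le: "norm (cis (real j * x) - 1) \<le> real j * norm (cis x - 1)"
proof (induction j)
  case (Suc j)
  have "cis (real (Suc j) * x) - 1 = cis x * (cis (real j * x) - 1) + (cis x - 1)"
    by (simp add: algebra_simps cis_mult)
  also have "norm \<dots> \<le> norm (cis (real j * x) - 1) + norm (cis x - 1)"
    by (rule order.trans[OF norm_triangle_ineq]) (simp add: norm_mult)
  finally show ?case using Suc by (simp add: algebra_simps)
qed simp

text \<open>Expanding the square gives characters of frequency \<open>(j - l) * d\<close>. As
  \<open>d \<noteq> 0\<close>, orthogonality leaves only the \<open>N\<close> diagonal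
  terms.\<close>

lemma expectation_Dirichlet_square:
  fixes d :: int
  assumes "d \<noteq> 0"
  shows "(\<integral>x. (norm (\<Sum>j<N. cis (real j * (of_int d * x))))\<^sup>2 \<partial>circle_angle) = real N"
proof -
  have eq: "complex_of_real ((norm (\<Sum>j<N. cis (real j * (of_int d * x))))\<^sup>2) =
      (\<Sum>j<N. \<Sum>l<N. cis (of_int ((int j - int l) * d) * x))" for x
    unfolding complex_norm_square
    by (simp add: sum_product cis_cnj cis_mult algebra_simps cnj_sum)
  have integrable_cis: "integrable circle_angle (\<lambda>x. cis (of_int k * x))" for k
    by (rule circle_angle.integrable_const_bound[where B=1]) auto
  have "complex_of_real (\<integral>x. (norm (\<Sum>j<N. cis (real j * (of_int d * x))))\<^sup>2 \<partial>circle_angle)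
      = (\<integral>x. (\<Sum>j<N. \<Sum>l<N. cis (of_int ((int j - int l) * d) * x)) \<partial>circle_angle)"
    unfolding integral_complex_of_real[symmetric] eq ..
  also have "\<dots> = (\<Sum>j<N. \<Sum>l<N. (\<integral>x. cis (of_int ((int j - int l) * d) * x) \<partial>circle_angle))"
    by (subst Bochner_Integration.integral_sum, (intro Bochner_Integration.integrable_sum integrable_cis)[1],
        intro sum.cong refl Bochner_Integration.integral_sum integrable_cis)
  also have "\<dots> = of_nat N"
    unfolding integral_cis_circle_angle using assms by (simp add: sum.delta)
  finally show ?thesis
    by (metis of_real_eq_iff of_real_of_nat_eq)
qed

text \<open>The Fejer kernel \<open>norm (\<Sum>j<N. cis (j * x))\<^sup>2 / N\<close> has mean 1 and is at least \<open>N/4\<close> where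
  \<open>norm (cis x - 1) \<le> 1 / (2 * N)\<close>.\<close>

lemma measure_cis_near_1:
  fixes d :: int
  assumes "d \<noteq> 0" "0 < \<eta>"
  shows "measure circle_angle {x. norm (cis (of_int d * x) - 1) \<le> \<eta>} \<le> 16 * \<eta>"
proof (cases "\<eta> < 1 / 4")
  case False
  then show ?thesis using circle_angle.prob_le_1[of "{x. norm (cis (of_int d * x) - 1) \<le> \<eta>}"] by linarith
next
  case True
  \<comment> \<open>Essentially the largest \<open>N\<close> with
    \<open>N * \<eta> \<le> 1 / 2\<close>: then every summand of the kernel lies within 1/2 of 1 on
    the set in question. For \<open>\<eta> \<ge> 1 / 4\<close> the claim was trivial.\<close>
  define N where "N = nat \<lfloor>1 / (2 * \<eta>)\<rfloor>"
  have "1 / (2 * \<eta>) \<ge> 2" using True assms by (simp add: field_simps)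
  then have N: "real N \<le> 1 / (2 * \<eta>)" "1 / (2 * \<eta>) < real N + 1" "N \<ge> 1"
    unfolding N_def by (simp_all add: le_nat_iff le_floor_iff) linarith+
  let ?D = "\<lambda>x. (norm (\<Sum>j<N. cis (real j * (of_int d * x))))\<^sup>2"
  let ?E = "{x. norm (cis (of_int d * x) - 1) \<le> \<eta>}"
  have large: "(real N / 2)\<^sup>2 \<le> ?D x" if "x \<in> ?E" for x
  proof -
    let ?y = "of_int d * x"
    have "norm (\<Sum>j<N. cis (real j * ?y) - 1) \<le> (\<Sum>j<N. 1 / 2)"
    proof (rule order.trans[OF norm_sum], rule sum_mono)
      fix j assume "j \<in> {..<N}"
      then have "real j * norm (cis ?y - 1) \<le> 1 / (2 * \<eta>) * \<eta>"
        using N that assms by (intro mult_mono) auto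
      then show "norm (cis (real j * ?y) - 1) \<le> 1 / 2"
        using norm_cis_mult_diff_le[of j ?y] assms by simp
    qed
    then have "norm ((\<Sum>j<N. cis (real j * ?y)) - of_nat N) \<le> real N / 2"
      by (simp add: sum_subtractf)
    then have "real N / 2 \<le> norm (\<Sum>j<N. cis (real j * ?y))"
      using norm_triangle_ineq2[of "of_nat N" "\<Sum>j<N. cis (real j * ?y)"]
      by (simp add: norm_minus_commute)
    then show ?thesis by (intro power_mono) auto
  qed
  have "(real N / 2)\<^sup>2 * measure circle_angle ?E = (\<integral>x. (real N / 2)\<^sup>2 * indicator ?E x \<partial>circle_angle)"
    by simp
  also have "\<dots> \<le> (\<integral>x. ?D x \<partial>circle_angle)"
  proof (rule integral_mono)
    show "integrable circle_angle ?D"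
    proof (rule circle_angle.integrable_const_bound[where B="(real N)\<^sup>2"])
      have "norm (\<Sum>j<N. cis (real j * (of_int d * x))) \<le> real N" for x
        by (rule order.trans[OF norm_sum]) simp
      then show "AE x in circle_angle. norm (?D x) \<le> (real N)\<^sup>2"
        by (auto intro!: power_mono)
    qed simp
    show "integrable circle_angle (\<lambda>x. (real N / 2)\<^sup>2 * indicator ?E x)"
      by (intro integrable_mult_right circle_angle.integrable_const_bound[where B=1])
         (simp_all add: indicator_def)
    show "(real N / 2)\<^sup>2 * indicator ?E x \<le> ?D x" for x
    proof (cases "x \<in> ?E")
      case True
      then show ?thesis using large[OF True] by simp
    qed simp
  qed
  also have "\<dots> = real N" by (rule expectation_Dirichlet_square) fact
  finally have "measure circle_angle ?E \<le> 4 / real N"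
    using N by (simp add: power2_eq_square field_simps)
  \<comment> \<open>From \<open>1 / (2 * \<eta>) \<ge> 2\<close> one gets
    \<open>N > 1 / (2 * \<eta>) - 1 \<ge> 1 / (4 * \<eta>)\<close>.\<close>
  also have "\<dots> \<le> 16 * \<eta>"
    using N assms \<open>1 / (2 * \<eta>) \<ge> 2\<close> by (simp add: field_simps)
  finally show ?thesis .
qed

section \<open>Small values of exponential sums\<close>

text \<open>The induction removes the term of frequency \<open>n k\<close> by passing from \<open>p\<close> to the twisted
  difference \<open>p (x + h) - cis (n k * h) * p x\<close>. If \<open>E\<close> is the set where \<open>p\<close> is small, then the square
  of the measure of \<open>E\<close> is the measure of the pairs \<open>(x, h)\<close> with \<open>x, x + h \<in> E\<close>, and for these the
  difference is small as well.\<close>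

lemma measure_small_exponential_sum:
  "\<exists>C \<delta>. 1 \<le> C \<and> 0 < \<delta> \<and> \<delta> \<le> (1::real) \<and>
     (\<forall>(B::'b set) m (a::'b \<Rightarrow> complex) (n::'b \<Rightarrow> int) y.
        finite B \<longrightarrow> card B = N \<longrightarrow> m \<notin> B \<longrightarrow> (\<forall>k\<in>B. n k \<noteq> n m) \<longrightarrow> a m \<noteq> 0 \<longrightarrow> 0 < y \<longrightarrow>
        measure circle_angle {x. norm (\<Sum>l\<in>insert m B. a l * cis (of_int (n l) * x)) \<le> y}
          \<le> C * (y / norm (a m)) powr \<delta>)"
proof (induction N)
  case 0
  show ?case
  \<comment> \<open>A single exponential has constant modulus \<open>norm (a m)\<close>, so the set
    is empty unless \<open>y \<ge> norm (a m)\<close>, and then the right-hand side is at least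
    1.\<close>
  proof (intro exI[of _ 1] conjI allI impI)
    fix B :: "'b set" and m and a :: "'b \<Rightarrow> complex" and n :: "'b \<Rightarrow> int" and y :: real
    assume *: "finite B" "card B = 0" "a m \<noteq> 0" "0 < y"
    show "measure circle_angle {x. norm (\<Sum>l\<in>insert m B. a l * cis (of_int (n l) * x)) \<le> y}
          \<le> 1 * (y / norm (a m)) powr 1"
    proof (cases "norm (a m) \<le> y")
      case True
      then have "1 \<le> y / norm (a m)" using * by (simp add: field_simps)
      then show ?thesis
        using * order.trans[OF circle_angle.prob_le_1] by simp
    qed (use * in \<open>auto simp: norm_mult\<close>)
  qed auto
next
  case (Suc N)
  then obtain C \<delta> where H: "1 \<le> C \<and> 0 < \<delta> \<and> \<delta> \<le> (1::real) \<and>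
     (\<forall>(B::'b set) m (a::'b \<Rightarrow> complex) (n::'b \<Rightarrow> int) y.
        finite B \<longrightarrow> card B = N \<longrightarrow> m \<notin> B \<longrightarrow> (\<forall>k\<in>B. n k \<noteq> n m) \<longrightarrow> a m \<noteq> 0 \<longrightarrow> 0 < y \<longrightarrow>
        measure circle_angle {x. norm (\<Sum>l\<in>insert m B. a l * cis (of_int (n l) * x)) \<le> y}
          \<le> C * (y / norm (a m)) powr \<delta>)"
    by (elim exE) (rule that)
  then have C: "1 \<le> C" and \<delta>: "0 < \<delta>" "\<delta> \<le> 1" by simp_all
  note IH = H[THEN conjunct2, THEN conjunct2, THEN conjunct2, rule_format]
  \<comment> \<open>16 comes from the exceptional shifts \<open>h\<close>
    (\<open>measure_cis_near_1\<close>), \<open>C * 2 powr \<delta>\<close> from the induction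
    hypothesis at level \<open>2 * y\<close>.\<close>
  define C' where "C' = 16 + C * 2 powr \<delta>"
  have C': "1 \<le> C'" using C by (simp add: C'_def add_increasing2)
  show ?case
  \<comment> \<open>The exponent is halved twice: by the threshold \<open>\<eta> = sqrt w\<close>,
    and by the final square root of the squared measure.\<close>
  proof (rule exI[of _ C'], rule exI[of _ "\<delta> / 4"], intro conjI allI impI)
    fix A :: "'b set" and m and a :: "'b \<Rightarrow> complex" and n :: "'b \<Rightarrow> int" and y :: real
    assume A: "finite A" "card A = Suc N" "m \<notin> A" "\<forall>k\<in>A. n k \<noteq> n m" "a m \<noteq> 0" "0 < y"
    then obtain k B where kB: "A = insert k B" "k \<notin> B" "card B = N"
      by (metis card_Suc_eq)
    have km: "k \<noteq> m" "n m - n k \<noteq> 0" using A kB by auto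
    have B: "finite B" "m \<notin> B" "\<forall>k\<in>B. n k \<noteq> n m" using A kB by auto
    define p where "p = (\<lambda>x. \<Sum>l\<in>insert m A. a l * cis (of_int (n l) * x))"
    \<comment> \<open>The twisted difference in expanded form. The coefficient of frequency
      \<open>n k\<close> cancels, so the sum runs over \<open>insert m B\<close> only.\<close>
    define D where "D = (\<lambda>h x. \<Sum>l\<in>insert m B.
       (a l * (cis (of_int (n l) * h) - cis (of_int (n k) * h))) * cis (of_int (n l) * x))"
    have p_eq: "p x = a k * cis (of_int (n k) * x) + (\<Sum>l\<in>insert m B. a l * cis (of_int (n l) * x))" for x
    proof -
      have "insert m A = insert k (insert m B)" using kB by auto
      then show ?thesis unfolding p_def using km kB B by simp
    qed
    have D_eq: "D h x = p (x + h) - cis (of_int (n k) * h) * p x" for h x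
      unfolding D_def p_eq
      by (simp add: algebra_simps cis_mult sum_subtractf sum_distrib_left del: sum.insert)
    define E where "E = {x. norm (p x) \<le> y}"
    have [measurable]: "p \<in> borel_measurable borel" unfolding p_def by measurable
    have [measurable]: "(\<lambda>z. D (fst z) (snd z)) \<in> borel_measurable (borel \<Otimes>\<^sub>M borel)"
      unfolding D_eq by measurable
    have [measurable]: "E \<in> sets borel" unfolding E_def by measurable
    define f :: "real \<Rightarrow> real \<Rightarrow> ennreal" where "f = (\<lambda>h x. indicator {x. norm (D h x) \<le> 2 * y} x)"
    have f_eq: "f h x = (if norm (D h x) \<le> 2 * y then 1 else 0)" for h x
      by (simp add: f_def)
    have f_meas [measurable]: "(\<lambda>z. f (fst z) (snd z)) \<in> borel_measurable (borel \<Otimes>\<^sub>M borel)"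
      unfolding f_eq by measurable
    have p_per: "p (x + 2 * pi) = p x" for x
    proof -
      have "cis (of_int (n l) * (x + 2 * pi)) = cis (of_int (n l) * x)" for l
        using cis_multiple_2pi[of "of_int (n l)"]
        by (simp add: algebra_simps flip: cis_mult)
      then show ?thesis unfolding p_def by simp
    qed
    have f_per: "f (h + 2 * pi) x = f h x" for h x
    proof -
      have "cis (of_int (n k) * (h + 2 * pi)) = cis (of_int (n k) * h)"
        using cis_multiple_2pi[of "of_int (n k)"]
        by (simp add: algebra_simps flip: cis_mult)
      then show ?thesis
        unfolding f_eq D_eq using p_per[of "x + h"] by (simp add: add.assoc)
    qed
    have ind_le: "indicator E x * indicator E x' \<le> f (x' - x) x" for x x'
    proof (cases "x \<in> E \<and> x' \<in> E")
      case True
      have "norm (D (x' - x) x) \<le> norm (p x') + norm (p x)"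
        unfolding D_eq by (rule order.trans[OF norm_triangle_ineq4]) (simp add: norm_mult)
      then have "norm (D (x' - x) x) \<le> 2 * y" using True by (simp add: E_def)
      then show ?thesis by (simp add: f_eq indicator_def)
    qed (auto simp: indicator_def)
    define w where "w = y / norm (a m)"
    have w: "0 < w" using A by (simp add: w_def)
    \<comment> \<open>Balances the two contributions: \<open>Z\<close> has measure at most
      \<open>16 * w powr (1/2)\<close>, and off \<open>Z\<close> the ratio of level to marked
      coefficient is at most \<open>2 * w powr (1/2)\<close>.\<close>
    define \<eta> where "\<eta> = sqrt w"
    have \<eta>: "0 < \<eta>" using w by (simp add: \<eta>_def)
    define Z where "Z = {h. norm (cis (of_int (n m - n k) * h) - 1) \<le> \<eta>}"
    have [measurable]: "Z \<in> sets borel" unfolding Z_def by measurable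
    \<comment> \<open>For \<open>h\<close> in \<open>Z\<close> the marked coefficient of
      \<open>D h\<close> may be tiny and the trivial bound 1 is used. Otherwise it has modulus at
      least \<open>norm (a m) * \<eta>\<close>, and the induction hypothesis applies.\<close>
    have slice: "(\<integral>\<^sup>+x. f h x \<partial>circle_angle) \<le>
        indicator Z h + ennreal (C * (2 * y / (norm (a m) * \<eta>)) powr \<delta>)" for h
    proof -
      have eq: "(\<integral>\<^sup>+x. f h x \<partial>circle_angle) = ennreal (measure circle_angle {x. norm (D h x) \<le> 2 * y})"
        unfolding f_def by (subst nn_integral_indicator) (simp_all add: D_eq circle_angle.emeasure_eq_measure)
      show ?thesis
      proof (cases "h \<in> Z")
        case True
        then show ?thesis unfolding eq
          by (simp add: add_increasing2)
      next
        case False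
        define b where "b = a m * (cis (of_int (n m) * h) - cis (of_int (n k) * h))"
        have "b = a m * cis (of_int (n k) * h) * (cis (of_int (n m - n k) * h) - 1)"
          unfolding b_def by (simp add: algebra_simps cis_mult)
        then have "norm b = norm (a m) * norm (cis (of_int (n m - n k) * h) - 1)"
          by (simp add: norm_mult)
        then have b: "norm (a m) * \<eta> \<le> norm b"
          using False by (auto simp: Z_def intro!: mult_left_mono)
        moreover have pos: "0 < norm (a m) * \<eta>" using A \<eta> by simp
        ultimately have "b \<noteq> 0" by auto
        then have "measure circle_angle {x. norm (D h x) \<le> 2 * y} \<le> C * (2 * y / norm b) powr \<delta>"
          unfolding D_def b_def using A B kB by (intro IH) auto
        also have "\<dots> \<le> C * (2 * y / (norm (a m) * \<eta>)) powr \<delta>"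
          using C \<delta> A b pos \<eta> \<open>b \<noteq> 0\<close> by (intro mult_left_mono powr_mono2 divide_left_mono mult_pos_pos) auto
        finally show ?thesis unfolding eq using False by (auto intro: ennreal_leI)
      qed
    qed
    interpret pair_prob_space circle_angle circle_angle ..
    have "emeasure circle_angle E * emeasure circle_angle E =
        (\<integral>\<^sup>+x. \<integral>\<^sup>+x'. indicator E x * indicator E x' \<partial>circle_angle \<partial>circle_angle)"
      by (simp add: nn_integral_cmult nn_integral_multc)
    also have "\<dots> \<le> (\<integral>\<^sup>+x. \<integral>\<^sup>+x'. f (x' - x) x \<partial>circle_angle \<partial>circle_angle)"
      by (intro nn_integral_mono ind_le)
    also have "\<dots> = (\<integral>\<^sup>+x. \<integral>\<^sup>+h. f h x \<partial>circle_angle \<partial>circle_angle)"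
    proof (rule nn_integral_cong_AE)
      \<comment> \<open>The rotation lemma covers shifts by angles in this interval, which carries
        all the mass.\<close>
      have "AE x in circle_angle. x \<in> {0..2 * pi}"
        unfolding circle_angle_def by (rule AE_uniform_measureI) auto
      then show "AE x in circle_angle. (\<integral>\<^sup>+x'. f (x' - x) x \<partial>circle_angle) = (\<integral>\<^sup>+h. f h x \<partial>circle_angle)"
      proof eventually_elim
        case (elim x)
        have "(\<lambda>h. f h x) \<in> borel_measurable borel"
          using measurable_compose[OF _ f_meas, of "\<lambda>h. (h, x)"] by simp
        from nn_integral_circle_angle_shift[OF this] show ?case using f_per elim by auto
      qed
    qed
    also have "\<dots> = (\<integral>\<^sup>+h. \<integral>\<^sup>+x. f h x \<partial>circle_angle \<partial>circle_angle)"
    proof (rule Fubini')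
      have "sets (circle_angle \<Otimes>\<^sub>M circle_angle) = sets (borel \<Otimes>\<^sub>M borel)"
        by (intro sets_pair_measure_cong) auto
      then show "case_prod f \<in> borel_measurable (circle_angle \<Otimes>\<^sub>M circle_angle)"
        using f_meas by (simp add: case_prod_beta' cong: measurable_cong_sets)
    qed
    also have "\<dots> \<le> (\<integral>\<^sup>+h. indicator Z h + ennreal (C * (2 * y / (norm (a m) * \<eta>)) powr \<delta>) \<partial>circle_angle)"
      by (intro nn_integral_mono slice)
    also have "\<dots> = emeasure circle_angle Z + ennreal (C * (2 * y / (norm (a m) * \<eta>)) powr \<delta>)"
      using circle_angle.emeasure_space_1 by (subst nn_integral_add) auto
    also have "\<dots> = ennreal (measure circle_angle Z + C * (2 * y / (norm (a m) * \<eta>)) powr \<delta>)"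
      using C by (simp add: circle_angle.emeasure_eq_measure ennreal_plus)
    finally have "ennreal (measure circle_angle E * measure circle_angle E) \<le>
        ennreal (measure circle_angle Z + C * (2 * y / (norm (a m) * \<eta>)) powr \<delta>)"
      by (simp only: circle_angle.emeasure_eq_measure ennreal_mult[symmetric] measure_nonneg)
    then have "measure circle_angle E * measure circle_angle E \<le>
        measure circle_angle Z + C * (2 * y / (norm (a m) * \<eta>)) powr \<delta>"
      using C by (subst (asm) ennreal_le_iff) (auto intro!: add_nonneg_nonneg)
    also have "2 * y / (norm (a m) * \<eta>) = 2 * w powr (1/2)"
    proof -
      have "2 * y / (norm (a m) * \<eta>) = 2 * (w / sqrt w)" by (simp add: \<eta>_def w_def)
      then show ?thesis using w by (simp add: real_div_sqrt powr_half_sqrt)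
    qed
    also have "\<dots> powr \<delta> = 2 powr \<delta> * w powr (\<delta> / 2)"
      using w by (simp add: powr_mult powr_powr)
    also have "measure circle_angle Z \<le> 16 * w powr (1/2)"
      using measure_cis_near_1[OF km(2) \<eta>] w unfolding Z_def \<eta>_def by (simp add: powr_half_sqrt)
    finally have sq: "(measure circle_angle E)\<^sup>2 \<le> 16 * w powr (1/2) + C * (2 powr \<delta> * w powr (\<delta> / 2))"
      by (simp add: power2_eq_square)
    have "measure circle_angle E \<le> C' * w powr (\<delta> / 4)"
    \<comment> \<open>Here \<open>\<delta> \<le> 1\<close> pays off: for \<open>w \<le> 1\<close>
      both terms are absorbed in \<open>w powr (\<delta> / 2)\<close>, and
      \<open>C' \<le> C'\<^sup>2\<close> makes the bound a square. For \<open>w > 1\<close> the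
      claimed bound exceeds 1.\<close>
    proof (cases "w \<le> 1")
      case True
      have "w powr (1/2) \<le> w powr (\<delta> / 2)"
        using True w \<delta> by (intro powr_mono') auto
      with sq have "(measure circle_angle E)\<^sup>2 \<le> C' * w powr (\<delta> / 2)"
        by (simp add: C'_def algebra_simps)
      also have "\<dots> \<le> C'\<^sup>2 * w powr (\<delta> / 2)"
        using C' by (intro mult_right_mono) (auto simp: power2_eq_square)
      also have "\<dots> = (C' * w powr (\<delta> / 4))\<^sup>2"
        using w by (simp add: power_mult_distrib power2_eq_square flip: powr_add)
      finally show ?thesis
        by (rule power2_le_imp_le) (use C' in auto)
    next
      case False
      then have "1 * 1 \<le> C' * w powr (\<delta> / 4)"
        using C' \<delta> by (intro mult_mono ge_one_powr_ge_zero) auto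
      then show ?thesis using order.trans[OF circle_angle.prob_le_1] by simp
    qed
    then show "measure circle_angle {x. norm (\<Sum>l\<in>insert m A. a l * cis (of_int (n l) * x)) \<le> y}
          \<le> C' * (y / norm (a m)) powr (\<delta> / 4)"
      by (simp add: E_def p_def w_def)
  qed (use C' \<delta> in auto)
qed

section \<open>Truncation of logarithms\<close>

text \<open>Dyadic layers: where \<open>X\<close> lies between \<open>2 powr (-(j + 1))\<close> and
  \<open>2 powr (-j)\<close> the integrand is at most
  \<open>2 powr ((j + 1) * \<delta> / 2)\<close>, on a set of measure at most
  \<open>C * 2 powr (-j * \<delta>)\<close>. Spending only half of the exponent leaves a geometric
  series of ratio \<open>2 powr (-(\<delta> / 2))\<close>.\<close>

lemma nn_integral_powr_neg_le:
  fixes X :: "'z \<Rightarrow> real"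
  assumes "prob_space M" and X [measurable]: "X \<in> borel_measurable M" and nonneg: "\<And>x. 0 \<le> X x"
    and C: "0 \<le> C" and \<delta>: "0 < \<delta>"
    and small: "\<And>y. 0 < y \<Longrightarrow> measure M {x \<in> space M. X x \<le> y} \<le> C * y powr \<delta>"
  shows "(\<integral>\<^sup>+x. ennreal (X x powr (-(\<delta> / 2))) \<partial>M)
           \<le> ennreal (1 + C * 2 powr (\<delta> / 2) / (1 - 2 powr (-(\<delta> / 2))))"
proof -
  interpret prob_space M by fact
  define \<epsilon> where "\<epsilon> = \<delta> / 2"
  have \<epsilon>: "0 < \<epsilon>" using \<delta> by (simp add: \<epsilon>_def)
  \<comment> \<open>The layers are enlarged to full sublevel sets, to which \<open>small\<close>
    applies directly.\<close>
  define T where "T = (\<lambda>(j::nat) x. ennreal (2 powr ((real j + 1) * \<epsilon>)) *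
    indicator {x \<in> space M. X x \<le> 2 powr (- real j)} x)"
  have T_meas [measurable]: "T j \<in> borel_measurable M" for j unfolding T_def by measurable
  have pointwise: "ennreal (X x powr (-\<epsilon>)) \<le> 1 + suminf (\<lambda>j. T j x)" if x: "x \<in> space M" for x
  \<comment> \<open>At \<open>X x = 0\<close> the library value of \<open>powr\<close> is 0, so that
    point belongs to the harmless case.\<close>
  proof (cases "X x = 0 \<or> 1 < X x")
    case True
    then have "X x powr (-\<epsilon>) \<le> 1"
      using \<epsilon> powr_mono[of "-\<epsilon>" 0 "X x"] by auto
    then have "ennreal (X x powr (-\<epsilon>)) \<le> ennreal 1" by (rule ennreal_leI)
    then show ?thesis by (simp add: add_increasing2)
  next
    case False
    then have X01: "0 < X x" "X x \<le> 1" using nonneg[of x] by auto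
    define l where "l = log 2 (1 / X x)"
    have l: "0 \<le> l" "X x = 2 powr (-l)" using X01 by (auto simp: l_def log_divide powr_minus)
    define j where "j = nat \<lfloor>l\<rfloor>"
    have j: "real j \<le> l" "l \<le> real j + 1" using l by (auto simp: j_def)
    have "X x powr (-\<epsilon>) = 2 powr (l * \<epsilon>)" by (simp add: l powr_powr)
    also have "\<dots> \<le> 2 powr ((real j + 1) * \<epsilon>)"
      using j \<epsilon> by (intro powr_mono mult_right_mono) auto
    finally have "ennreal (X x powr (-\<epsilon>)) \<le> T j x"
      using j x l by (auto simp: T_def intro!: ennreal_leI)
    also have "\<dots> \<le> suminf (\<lambda>j. T j x)"
      using sum_le_suminf[of "\<lambda>j. T j x" "{j}"] by simp
    finally show ?thesis by (simp add: add_increasing)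
  qed
  define q where "q = 2 powr (-\<epsilon>)"
  have q: "0 \<le> q" "q < 1" using \<epsilon> by (auto simp: q_def powr_less_one)
  have T_int: "(\<integral>\<^sup>+x. T j x \<partial>M) \<le> ennreal (C * 2 powr \<epsilon> * q ^ j)" for j
  proof -
    have "(\<integral>\<^sup>+x. T j x \<partial>M) =
        ennreal (2 powr ((real j + 1) * \<epsilon>) * measure M {x \<in> space M. X x \<le> 2 powr (- real j)})"
      unfolding T_def by (simp add: nn_integral_cmult emeasure_eq_measure ennreal_mult)
    also have "\<dots> \<le> ennreal (2 powr ((real j + 1) * \<epsilon>) * (C * (2 powr (- real j)) powr \<delta>))"
      by (intro ennreal_leI mult_left_mono small) auto
    also have "2 powr ((real j + 1) * \<epsilon>) * (C * (2 powr (- real j)) powr \<delta>) = C * 2 powr \<epsilon> * q ^ j"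
    proof -
      have "q ^ j = 2 powr (- \<epsilon> * real j)"
        by (simp add: q_def powr_powr flip: powr_realpow)
      moreover have "2 powr ((real j + 1) * \<epsilon>) * 2 powr (- real j * \<delta>) = 2 powr \<epsilon> * 2 powr (- \<epsilon> * real j)"
        unfolding powr_add[symmetric] by (simp add: \<epsilon>_def field_simps)
      ultimately show ?thesis by (simp add: powr_powr)
    qed
    finally show ?thesis .
  qed
  have "(\<integral>\<^sup>+x. ennreal (X x powr (-\<epsilon>)) \<partial>M) \<le> (\<integral>\<^sup>+x. 1 + suminf (\<lambda>j. T j x) \<partial>M)"
    by (intro nn_integral_mono pointwise)
  also have "\<dots> = 1 + suminf (\<lambda>j. \<integral>\<^sup>+x. T j x \<partial>M)"
    by (subst nn_integral_add) (auto simp: nn_integral_suminf emeasure_space_1)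
  also have "\<dots> \<le> 1 + suminf (\<lambda>j. ennreal (C * 2 powr \<epsilon> * q ^ j))"
    by (intro add_left_mono suminf_le T_int) auto
  also have "suminf (\<lambda>j. ennreal (C * 2 powr \<epsilon> * q ^ j)) = ennreal (C * 2 powr \<epsilon> * (1 / (1 - q)))"
  proof (rule suminf_ennreal_eq)
    show "(\<lambda>j. C * 2 powr \<epsilon> * q ^ j) sums (C * 2 powr \<epsilon> * (1 / (1 - q)))"
      using q by (intro sums_mult geometric_sums) auto
  qed (use C q in auto)
  also have "1 + \<dots> = ennreal (1 + C * 2 powr \<epsilon> / (1 - q))"
    using C q by (simp flip: ennreal_1 ennreal_plus)
  finally show ?thesis by (simp add: q_def \<epsilon>_def)
qed

text \<open>Cutting off inside the logarithm keeps the function continuous at zeros for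
  \<open>0 < y\<close>, and away from the default value of \<open>ln 0\<close>.\<close>

definition trunc_ln :: "real \<Rightarrow> complex \<Rightarrow> real" where
  "trunc_ln y z = ln (max (norm z) y)"

text \<open>Let \<open>m\<close> be the smallest modulus, capped at 1. If \<open>y \<le> m\<close>,
  nothing is truncated. Otherwise both values are at most a constant times
  \<open>m powr (-\<eta>)\<close>, and
  \<open>m powr (-\<eta>) = m powr \<eta> * m powr (-(2 * \<eta>))\<close> with \<open>m < y\<close>
  trades part of the singularity for the factor \<open>y powr \<eta>\<close>.\<close>

lemma trunc_ln_pointwise:
  fixes p :: "nat \<Rightarrow> complex" and g :: "(nat \<Rightarrow> real) \<Rightarrow> real"
  assumes bound: "\<And>u L. (\<And>i. i \<in> {1..s} \<Longrightarrow> \<bar>u i\<bar> \<le> L) \<Longrightarrow> \<bar>g u\<bar> \<le> (1 + L) ^ s"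
    and cong: "\<And>u v. (\<And>i. i \<in> {1..s} \<Longrightarrow> u i = v i) \<Longrightarrow> g u = g v"
    and s: "1 \<le> s" and B: "1 \<le> B" and \<eta>: "0 < \<eta>" and y: "0 < y" "y < 1"
    and p: "\<And>i. i \<in> {1..s} \<Longrightarrow> p i \<noteq> 0" "\<And>i. i \<in> {1..s} \<Longrightarrow> norm (p i) \<le> B"
  shows "\<bar>g (\<lambda>i. ln (norm (p i))) - g (\<lambda>i. trunc_ln y (p i))\<bar>
    \<le> 2 * (1 + ln B + real s / \<eta>) ^ s * y powr \<eta> * (1 + (\<Sum>i=1..s. norm (p i) powr (-(2 * \<eta>))))"
proof -
  \<comment> \<open>Inserting 1 ensures \<open>m \<le> 1\<close>, hence
    \<open>ln m \<le> 0\<close>.\<close>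
  define S where "S = insert 1 ((\<lambda>i. norm (p i)) ` {1..s})"
  define m where "m = Min S"
  define R where "R = (1 + (\<Sum>i=1..s. norm (p i) powr (-(2 * \<eta>))))"
  define K where "K = (1 + ln B + real s / \<eta>) ^ s"
  have S: "finite S" "S \<noteq> {}" by (auto simp: S_def)
  have m_in: "m \<in> S" unfolding m_def by (rule Min_in[OF S])
  have m_le: "m \<le> x" if "x \<in> S" for x using that S by (simp add: m_def)
  have m: "0 < m" "m \<le> 1" using m_in p m_le[of 1] by (auto simp: S_def)
  have m_p: "m \<le> norm (p i)" if "i \<in> {1..s}" for i using that by (intro m_le) (auto simp: S_def)
  have K: "0 \<le> K" unfolding K_def using B \<eta> by (intro zero_le_power add_nonneg_nonneg) auto
  have R: "0 \<le> R" unfolding R_def by (intro add_nonneg_nonneg sum_nonneg) auto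
  have "\<bar>g (\<lambda>i. ln (norm (p i))) - g (\<lambda>i. trunc_ln y (p i))\<bar> \<le> 2 * K * y powr \<eta> * R"
  proof (cases "y \<le> m")
    case True
    have "g (\<lambda>i. ln (norm (p i))) = g (\<lambda>i. trunc_ln y (p i))"
    proof (rule cong)
      fix i assume "i \<in> {1..s}"
      from m_p[OF this] True show "ln (norm (p i)) = trunc_ln y (p i)"
        by (simp add: trunc_ln_def max_absorb1)
    qed
    then show ?thesis using K R by simp
  next
    case False
    define L where "L = ln B - ln m"
    have ln_L: "\<bar>ln t\<bar> \<le> L" if "m \<le> t" "t \<le> B" for t
    proof -
      have "ln m \<le> ln t" "ln t \<le> ln B" "ln m \<le> 0" "0 \<le> ln B" using that m B by auto
      then show ?thesis by (simp add: L_def abs_if)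
    qed
    have "\<bar>g (\<lambda>i. ln (norm (p i)))\<bar> \<le> (1 + L) ^ s"
      by (intro bound ln_L m_p p)
    moreover have "\<bar>g (\<lambda>i. trunc_ln y (p i))\<bar> \<le> (1 + L) ^ s"
      unfolding trunc_ln_def using m_p p y B False
      by (intro bound ln_L) (auto simp: le_max_iff_disj)
    moreover have "(1 + L) ^ s \<le> K * m powr (-\<eta>)"
    proof -
      \<comment> \<open>A logarithm is at most \<open>m powr (-a) / a\<close>; with this
        \<open>a\<close> its \<open>s\<close>-th power costs exactly
        \<open>m powr (-\<eta>)\<close>.\<close>
      define a where "a = \<eta> / real s"
      have a: "0 < a" using \<eta> s by (simp add: a_def)
      have "1 \<le> 1 / m" using m by simp
      then have "ln (1 / m) \<le> (1 / m) powr a / a" using a by (rule ln_powr_bound)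
      also have "(1 / m) powr a = m powr (-a)" using m by (simp add: powr_divide powr_minus_divide)
      finally have ln1: "- ln m \<le> m powr (-a) / a" using m by (simp add: ln_div)
      have "m powr 0 \<le> m powr (-a)" using m a by (intro powr_mono') auto
      then have "(1 + ln B) * 1 \<le> (1 + ln B) * m powr (-a)"
        using B m by (intro mult_left_mono) auto
      with ln1 have "1 + L \<le> (1 + ln B + 1 / a) * m powr (-a)"
        by (simp add: L_def algebra_simps)
      moreover have "0 \<le> 1 + L" using m B by (simp add: L_def)
      ultimately have "(1 + L) ^ s \<le> ((1 + ln B + 1 / a) * m powr (-a)) ^ s"
        by (intro power_mono)
      also have "\<dots> = K * m powr (-\<eta>)"
      proof -
        have "(m powr (-a)) ^ s = m powr (-a * real s)"
          using m by (subst powr_realpow[symmetric]) (auto simp: powr_powr)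
        also have "- a * real s = - \<eta>" using s by (simp add: a_def)
        finally show ?thesis by (simp add: K_def a_def power_mult_distrib)
      qed
      finally show ?thesis .
    qed
    moreover have "m powr (-\<eta>) \<le> y powr \<eta> * R"
    proof -
      have "m powr (-\<eta>) = m powr \<eta> * m powr (-(2 * \<eta>))"
        using m by (simp flip: powr_add)
      also have "\<dots> \<le> y powr \<eta> * m powr (-(2 * \<eta>))"
        using False m \<eta> by (intro mult_right_mono powr_mono2) auto
      also have "m powr (-(2 * \<eta>)) \<le> R"
      proof -
        from m_in consider "m = 1" | i where "i \<in> {1..s}" "m = norm (p i)" by (auto simp: S_def)
        then show ?thesis
        proof cases
          case 1
          then show ?thesis by (auto simp: R_def intro!: sum_nonneg)
        next
          case 2
          then have "m powr (-(2 * \<eta>)) \<le> (\<Sum>i=1..s. norm (p i) powr (-(2 * \<eta>)))"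
            by (auto intro!: member_le_sum)
          then show ?thesis by (simp add: R_def)
        qed
      qed
      finally show ?thesis by (simp add: mult_left_mono)
    qed
    then have "K * m powr (-\<eta>) \<le> K * (y powr \<eta> * R)" using K by (rule mult_left_mono)
    ultimately show ?thesis by (simp add: mult.assoc)
  qed
  then show ?thesis by (simp add: K_def R_def)
qed

text \<open>\<open>K\<close> and \<open>\<eta>\<close> are obtained before \<open>M\<close>,
  \<open>p\<close> and \<open>y\<close>: the same constants must serve the torus and all power
  curves. The pointwise estimate is integrated with the negative moment bound.\<close>

lemma trunc_ln_integral:
  fixes g :: "(nat \<Rightarrow> real) \<Rightarrow> real"
  assumes bound: "\<And>u L. (\<And>i. i \<in> {1..s} \<Longrightarrow> \<bar>u i\<bar> \<le> L) \<Longrightarrow> \<bar>g u\<bar> \<le> (1 + L) ^ s"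
    and cong: "\<And>u v. (\<And>i. i \<in> {1..s} \<Longrightarrow> u i = v i) \<Longrightarrow> g u = g v"
    and s: "1 \<le> s" and B: "1 \<le> B" and C: "0 \<le> C" and \<delta>: "0 < \<delta>"
  obtains K \<eta> where "0 < \<eta>" and
    "\<And>M (p :: nat \<Rightarrow> 'z \<Rightarrow> complex) y. \<lbrakk>prob_space M; \<And>i. i \<in> {1..s} \<Longrightarrow> p i \<in> borel_measurable M;
       (\<lambda>x. g (\<lambda>i. ln (norm (p i x)))) \<in> borel_measurable M;
       (\<lambda>x. g (\<lambda>i. trunc_ln y (p i x))) \<in> borel_measurable M;
       \<And>i. i \<in> {1..s} \<Longrightarrow> AE x in M. norm (p i x) \<le> B;
       \<And>i t. i \<in> {1..s} \<Longrightarrow> 0 < t \<Longrightarrow> measure M {x \<in> space M. norm (p i x) \<le> t} \<le> C * t powr \<delta>;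
       0 < y; y < 1\<rbrakk> \<Longrightarrow>
       \<bar>(\<integral>x. g (\<lambda>i. ln (norm (p i x))) \<partial>M) - (\<integral>x. g (\<lambda>i. trunc_ln y (p i x)) \<partial>M)\<bar> \<le> K * y powr \<eta>"
proof -
  \<comment> \<open>Makes \<open>2 * \<eta>\<close> the exponent \<open>\<delta> / 2\<close> of the
    moment bound.\<close>
  define \<eta> where "\<eta> = \<delta> / 4"
  have \<eta>: "0 < \<eta>" using \<delta> by (simp add: \<eta>_def)
  define c where "c = 1 + C * 2 powr (\<delta> / 2) / (1 - 2 powr (-(\<delta> / 2)))"
  define K where "K = 2 * (1 + ln B + real s / \<eta>) ^ s"
  have K: "0 \<le> K" unfolding K_def using B \<eta> by (intro mult_nonneg_nonneg zero_le_power add_nonneg_nonneg) auto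
  have c: "0 \<le> c" unfolding c_def using C \<delta>
    by (intro add_nonneg_nonneg divide_nonneg_nonneg mult_nonneg_nonneg) (auto simp: powr_le_one_le powr_less_one less_imp_le)
  show thesis
  proof (rule that[of \<eta> "K * (1 + real s * c)"])
    fix M and p :: "nat \<Rightarrow> 'z \<Rightarrow> complex" and y
    assume M: "prob_space M" and p [measurable]: "\<And>i. i \<in> {1..s} \<Longrightarrow> p i \<in> borel_measurable M"
      and F [measurable]: "(\<lambda>x. g (\<lambda>i. ln (norm (p i x)))) \<in> borel_measurable M"
      and Fy [measurable]: "(\<lambda>x. g (\<lambda>i. trunc_ln y (p i x))) \<in> borel_measurable M"
      and pB: "\<And>i. i \<in> {1..s} \<Longrightarrow> AE x in M. norm (p i x) \<le> B"
      and small: "\<And>i t. i \<in> {1..s} \<Longrightarrow> 0 < t \<Longrightarrow> measure M {x \<in> space M. norm (p i x) \<le> t} \<le> C * t powr \<delta>"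
      and y: "0 < y" "y < 1"
    interpret prob_space M by fact
    let ?F = "\<lambda>x. g (\<lambda>i. ln (norm (p i x)))" and ?Fy = "\<lambda>x. g (\<lambda>i. trunc_ln y (p i x))"
    have nn: "(\<integral>\<^sup>+x. ennreal (norm (p i x) powr (-(2 * \<eta>))) \<partial>M) \<le> ennreal c" if "i \<in> {1..s}" for i
      using nn_integral_powr_neg_le[OF M _ _ C \<delta> small[OF that], of] p[OF that]
      by (simp add: c_def \<eta>_def)
    have int_p: "integrable M (\<lambda>x. norm (p i x) powr (-(2 * \<eta>)))" if "i \<in> {1..s}" for i
      using nn[OF that] p[OF that]
      by (intro integrableI_bounded) (auto simp: ennreal_less_top intro: le_less_trans)
    have int_p_le: "(\<integral>x. norm (p i x) powr (-(2 * \<eta>)) \<partial>M) \<le> c" if "i \<in> {1..s}" for i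
      using nn[OF that] nn_integral_eq_integral[OF int_p[OF that]] c by simp
    \<comment> \<open>Letting \<open>t\<close> tend to 0 in \<open>small\<close> shows that zeros
      form a null set, so the value of \<open>ln 0\<close> does not affect the integrals.\<close>
    have nz: "AE x in M. p i x \<noteq> 0" if i: "i \<in> {1..s}" for i
    proof -
      have "measure M {x \<in> space M. p i x = 0} \<le> 0"
      proof (rule tendsto_lowerbound)
        show "((\<lambda>t. C * t powr \<delta>) \<longlongrightarrow> 0) (at_right 0)"
          using \<delta> by (auto intro!: tendsto_eq_intros simp: eventually_at_filter)
        show "\<forall>\<^sub>F t in at_right 0. measure M {x \<in> space M. p i x = 0} \<le> C * t powr \<delta>"
          unfolding eventually_at_right_field
        proof (intro exI[of _ 1] conjI allI impI)
          fix t :: real assume "0 < t"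
          then show "measure M {x \<in> space M. p i x = 0} \<le> C * t powr \<delta>"
            using p[OF i] by (intro order.trans[OF finite_measure_mono small[OF i]]) auto
        qed auto
      qed auto
      then have "emeasure M {x \<in> space M. p i x = 0} = 0"
        by (simp add: emeasure_eq_measure measure_le_0_iff)
      then show ?thesis using p[OF i] by (subst AE_iff_measurable[OF _ refl]) auto
    qed
    let ?R = "\<lambda>x. 1 + (\<Sum>i=1..s. norm (p i x) powr (-(2 * \<eta>)))"
    have int_R: "integrable M (\<lambda>x. K * y powr \<eta> * ?R x)"
      by (intro integrable_mult_right Bochner_Integration.integrable_add Bochner_Integration.integrable_sum int_p) auto
    have diff: "AE x in M. \<bar>?F x - ?Fy x\<bar> \<le> K * y powr \<eta> * ?R x"
    proof -
      have "AE x in M. \<forall>i\<in>{1..s}. p i x \<noteq> 0" "AE x in M. \<forall>i\<in>{1..s}. norm (p i x) \<le> B"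
        using nz pB by (auto intro!: AE_finite_allI)
      then show ?thesis
      proof eventually_elim
        case (elim x)
        then show ?case
          unfolding K_def by (intro trunc_ln_pointwise[OF bound cong s B \<eta> y]) auto
      qed
    qed
    have Fy_bd: "AE x in M. norm (?Fy x) \<le> (1 + (\<bar>ln B\<bar> + \<bar>ln y\<bar>)) ^ s"
    proof -
      have "AE x in M. \<forall>i\<in>{1..s}. norm (p i x) \<le> B"
        using pB by (auto intro!: AE_finite_allI)
      then show ?thesis
      proof eventually_elim
        case (elim x)
        have "\<bar>trunc_ln y (p i x)\<bar> \<le> \<bar>ln B\<bar> + \<bar>ln y\<bar>" if "i \<in> {1..s}" for i
        proof -
          have "y \<le> max (norm (p i x)) y" "max (norm (p i x)) y \<le> B" using elim that y B by auto
          then have "ln y \<le> trunc_ln y (p i x)" "trunc_ln y (p i x) \<le> ln B"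
            using y by (auto simp: trunc_ln_def)
          then show ?thesis by linarith
        qed
        then show ?case unfolding real_norm_def by (rule bound)
      qed
    qed
    have int_Fy: "integrable M ?Fy" by (rule integrable_const_bound[OF Fy_bd]) fact
    \<comment> \<open>Integrability of the logarithmic integrand is not assumed: it follows from
      this dominated difference and the bounded truncation.\<close>
    have int_d: "integrable M (\<lambda>x. ?F x - ?Fy x)"
      by (rule Bochner_Integration.integrable_bound[OF int_R]) (use diff in \<open>auto elim!: eventually_mono\<close>)
    have int_F: "integrable M ?F"
      using Bochner_Integration.integrable_add[OF int_d int_Fy] by simp
    have "\<bar>(\<integral>x. ?F x \<partial>M) - (\<integral>x. ?Fy x \<partial>M)\<bar> = \<bar>\<integral>x. ?F x - ?Fy x \<partial>M\<bar>"
      using int_F int_Fy by simp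
    also have "\<dots> \<le> (\<integral>x. K * y powr \<eta> * ?R x \<partial>M)"
      by (rule integral_abs_bound[THEN order.trans], rule integral_mono_AE)
         (use int_d int_R diff in auto)
    also have "\<dots> = K * y powr \<eta> * (1 + (\<Sum>i=1..s. \<integral>x. norm (p i x) powr (-(2 * \<eta>)) \<partial>M))"
    proof -
      have "(\<integral>x. ?R x \<partial>M) = 1 + (\<integral>x. (\<Sum>i=1..s. norm (p i x) powr (-(2 * \<eta>))) \<partial>M)"
        using prob_space
        by (subst Bochner_Integration.integral_add) (auto intro!: Bochner_Integration.integrable_sum int_p)
      also have "(\<integral>x. (\<Sum>i=1..s. norm (p i x) powr (-(2 * \<eta>))) \<partial>M) =
          (\<Sum>i=1..s. \<integral>x. norm (p i x) powr (-(2 * \<eta>)) \<partial>M)"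
        by (rule Bochner_Integration.integral_sum) (rule int_p)
      finally show ?thesis by simp
    qed
    also have "\<dots> \<le> K * y powr \<eta> * (1 + (\<Sum>i=1..s. c))"
      using K by (intro mult_left_mono add_left_mono sum_mono int_p_le) auto
    finally show "\<bar>(\<integral>x. ?F x \<partial>M) - (\<integral>x. ?Fy x \<partial>M)\<bar> \<le> K * (1 + real s * c) * y powr \<eta>"
      by (simp add: algebra_simps)
  qed fact
qed

section \<open>Haar measure of the torus and power curves\<close>

lemma borel_measurable_vec_lambda_cis:
  assumes "\<And>j. continuous_on UNIV (f j)"
  shows "(\<lambda>x. \<chi> j. cis (f j x)) \<in> borel_measurable (borel :: 'a::topological_space measure)"
  by (intro borel_measurable_continuous_onI continuous_intros assms)

section \<open>Lebesgue measure in coordinates\<close>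

lemma prod_Basis_vec:
  fixes F :: "real ^ ('n::finite) \<Rightarrow> 'a::comm_monoid_mult"
  shows "(\<Prod>b\<in>Basis. F b) = (\<Prod>j\<in>UNIV. F (axis j 1))"
proof -
  have B: "(Basis :: (real ^ 'n) set) = (\<lambda>j. axis j 1) ` UNIV" by (auto simp: Basis_vec_def)
  have inj: "inj (\<lambda>j::'n. axis j (1::real))" by (auto intro!: injI simp: axis_eq_axis)
  show ?thesis unfolding B prod.reindex[OF inj] o_def ..
qed

lemma integral_lborel_prod_vec:
  fixes F :: "'n::finite \<Rightarrow> real \<Rightarrow> complex"
  assumes F: "\<And>j. integrable lborel (F j)"
  shows "(\<integral>\<theta>. (\<Prod>j\<in>UNIV. F j (\<theta> $ j)) \<partial>(lborel :: (real ^ 'n) measure)) = (\<Prod>j\<in>UNIV. \<integral>x. F j x \<partial>lborel)"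
proof -
  \<comment> \<open>Inverse of \<open>\<lambda>j. axis j 1\<close>: the product representation of
    \<open>lborel\<close> is indexed by basis vectors, the factors \<open>F\<close> by
    coordinates.\<close>
  define idx where "idx = (\<lambda>b :: real ^ 'n. THE j. b = axis j 1)"
  have idx [simp]: "idx (axis j 1) = j" for j
    unfolding idx_def by (auto simp: axis_eq_axis)
  have [measurable]: "F j \<in> borel_measurable borel" for j using F[of j] by auto
  interpret product_sigma_finite "\<lambda>b :: real ^ 'n. lborel :: real measure" ..
  have "(\<integral>\<theta>. (\<Prod>j\<in>UNIV. F j (\<theta> $ j)) \<partial>(lborel :: (real ^ 'n) measure)) =
      (\<integral>\<theta>. (\<Prod>b\<in>Basis. F (idx b) (\<theta> \<bullet> b)) \<partial>lborel)"
    by (simp add: prod_Basis_vec inner_axis)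
  also have "\<dots> = (\<integral>f. (\<Prod>b\<in>Basis. F (idx b) ((\<Sum>b\<in>Basis. f b *\<^sub>R b) \<bullet> b)) \<partial>(\<Pi>\<^sub>M b\<in>(Basis :: (real ^ 'n) set). lborel))"
    by (subst lborel_eq) (subst integral_distr, measurable)
  also have "\<dots> = (\<integral>f. (\<Prod>b\<in>Basis. F (idx b) (f b)) \<partial>(\<Pi>\<^sub>M b\<in>(Basis :: (real ^ 'n) set). lborel))"
    by (intro Bochner_Integration.integral_cong prod.cong) (auto simp: inner_sum_left_Basis)
  also have "\<dots> = (\<Prod>b\<in>(Basis :: (real ^ 'n) set). \<integral>x. F (idx b) x \<partial>lborel)"
    by (rule product_integral_prod) (auto intro: F)
  finally show ?thesis by (simp add: prod_Basis_vec)
qed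

text \<open>Univariate Mahler measures are integrals over vectors of length one; this identifies
  them with integrals over a real angle.\<close>

lemma distr_lborel_vec1: "distr (lborel :: (real ^ 1) measure) lborel (\<lambda>\<theta>. \<theta> $ 1) = lborel"
proof -
  have B: "(Basis :: (real ^ 1) set) = {axis 1 1}"
    by (auto simp: Basis_vec_def axis_eq_axis)
  interpret product_sigma_finite "\<lambda>b :: real ^ 1. lborel :: real measure" ..
  have "distr (lborel :: (real ^ 1) measure) lborel (\<lambda>\<theta>. \<theta> $ 1) =
      distr (distr (\<Pi>\<^sub>M b\<in>{axis 1 1 :: real ^ 1}. lborel) borel (\<lambda>f. \<Sum>b\<in>{axis 1 1}. f b *\<^sub>R b)) lborel (\<lambda>\<theta>. \<theta> $ 1)"
    by (subst lborel_eq) (simp add: B)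
  also have "\<dots> = distr (\<Pi>\<^sub>M b\<in>{axis 1 1 :: real ^ 1}. lborel) lborel ((\<lambda>\<theta>. \<theta> $ 1) \<circ> (\<lambda>f. \<Sum>b\<in>{axis 1 1}. f b *\<^sub>R b))"
    by (rule distr_distr) (auto intro!: borel_measurable_continuous_onI continuous_intros)
  also have "\<dots> = distr (\<Pi>\<^sub>M b\<in>{axis 1 1 :: real ^ 1}. lborel) lborel (\<lambda>f. f (axis 1 1))"
    by (intro distr_cong) (auto simp: axis_def)
  also have "\<dots> = lborel" by (rule distr_singleton)
  finally show ?thesis .
qed

section \<open>The two probability measures to be compared\<close>

definition torus :: "(complex ^ 'n) set" where
  "torus = {z. \<forall>j. norm (z $ j) = 1}"

text \<open>Like \<open>power_curve\<close>, this is a Borel measure on the whole space concentrated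
  on the torus, so both can integrate the same functions.\<close>

definition torus_haar :: "(complex ^ ('n::finite)) measure" where
  "torus_haar = distr (uniform_measure lborel (cbox 0 (\<chi> j. 2 * pi))) borel (\<lambda>\<theta>. \<chi> j. cis (\<theta> $ j))"

definition power_curve :: "('n::finite \<Rightarrow> nat) \<Rightarrow> (complex ^ 'n) measure" where
  "power_curve r = distr circle_angle borel (\<lambda>x. \<chi> j. cis (real (r j) * x))"

lemma compact_torus: "compact (torus :: (complex ^ ('n::finite)) set)"
proof -
  have "torus = (\<Inter>j. {z :: complex ^ 'n. norm (z $ j) = 1})" by (auto simp: torus_def)
  moreover have "closed {z :: complex ^ 'n. norm (z $ j) = 1}" for j
    by (intro closed_Collect_eq continuous_intros)
  moreover have "bounded (torus :: (complex ^ 'n) set)"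
  proof (rule boundedI)
    fix z :: "complex ^ 'n" assume "z \<in> torus"
    then show "norm z \<le> real CARD('n)"
      unfolding norm_vec_def by (intro order.trans[OF L2_set_le_sum]) (auto simp: torus_def)
  qed
  ultimately show ?thesis
    unfolding compact_eq_bounded_closed by (metis (no_types, lifting) closed_INT)
qed

lemma measurable_torus_param [measurable]: "(\<lambda>\<theta>. \<chi> j. cis (\<theta> $ j)) \<in> borel_measurable (borel :: (real ^ ('n::finite)) measure)"
  by (intro borel_measurable_vec_lambda_cis continuous_intros)

lemma measurable_power_curve_param [measurable]:
  "(\<lambda>x. \<chi> j. cis (real (r j) * x)) \<in> borel_measurable borel"
  by (intro borel_measurable_vec_lambda_cis continuous_intros)

lemma sets_torus_haar [measurable_cong, simp]: "sets torus_haar = sets borel"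
  and space_torus_haar [simp]: "space torus_haar = UNIV"
  and sets_power_curve [measurable_cong, simp]: "sets (power_curve r) = sets borel"
  and space_power_curve [simp]: "space (power_curve r) = UNIV"
  by (simp_all add: torus_haar_def power_curve_def)

lemma measure_angle_box:
  "emeasure lborel (cbox 0 (\<chi> j::'n::finite. 2 * pi)) = ennreal ((2 * pi) ^ CARD('n))"
  "measure lborel (cbox 0 (\<chi> j::'n::finite. 2 * pi)) = (2 * pi) ^ CARD('n)"
proof -
  have "0 \<le> (\<chi> j::'n. 2 * pi) \<bullet> b" if "b \<in> Basis" for b
    using that by (auto simp: Basis_vec_def inner_axis)
  then show "emeasure lborel (cbox 0 (\<chi> j::'n::finite. 2 * pi)) = ennreal ((2 * pi) ^ CARD('n))"
    by (subst emeasure_lborel_cbox) (auto simp: prod_Basis_vec inner_axis)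
  then show "measure lborel (cbox 0 (\<chi> j::'n::finite. 2 * pi)) = (2 * pi) ^ CARD('n)"
    by (simp add: measure_def)
qed

lemma prob_space_torus_haar: "prob_space (torus_haar :: (complex ^ ('n::finite)) measure)"
proof -
  interpret prob_space "uniform_measure lborel (cbox 0 (\<chi> j::'n. 2 * pi))"
    by (rule prob_space_uniform_measure) (auto simp: measure_angle_box)
  show ?thesis unfolding torus_haar_def by (rule prob_space_distr) simp
qed

lemma prob_space_power_curve: "prob_space (power_curve r)"
  unfolding power_curve_def by (rule circle_angle.prob_space_distr) simp

lemma AE_torus_haar: "AE z in torus_haar. z \<in> (torus :: (complex ^ ('n::finite)) set)"
  and AE_power_curve: "AE z in power_curve r. z \<in> (torus :: (complex ^ 'n) set)"
proof -
  have "closed (torus :: (complex ^ 'n) set)" using compact_torus by (rule compact_imp_closed)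
  then have [measurable]: "(torus :: (complex ^ 'n) set) \<in> sets borel" by (rule borel_closed)
  show "AE z in torus_haar. z \<in> (torus :: (complex ^ 'n) set)"
    unfolding torus_haar_def by (subst AE_distr_iff) (auto, auto simp: torus_def)
  show "AE z in power_curve r. z \<in> torus"
    unfolding power_curve_def by (subst AE_distr_iff) (auto, auto simp: torus_def)
qed

lemma integral_torus_haar:
  fixes f :: "complex ^ ('n::finite) \<Rightarrow> 'a::{banach, second_countable_topology}"
  assumes [measurable]: "f \<in> borel_measurable borel"
  shows "(\<integral>z. f z \<partial>torus_haar) = (1 / (2 * pi) ^ CARD('n)) *\<^sub>R
     (\<integral>\<theta>. indicator (cbox 0 (\<chi> j. 2 * pi)) \<theta> *\<^sub>R f (\<chi> j. cis (\<theta> $ j)) \<partial>lborel)"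
  unfolding torus_haar_def
  by (subst integral_distr, simp, simp, subst integral_uniform_measure) (auto simp: measure_angle_box)

lemma integral_power_curve:
  fixes f :: "complex ^ ('n::finite) \<Rightarrow> 'a::{banach, second_countable_topology}"
  assumes [measurable]: "f \<in> borel_measurable borel"
  shows "(\<integral>z. f z \<partial>power_curve r) = (\<integral>x. f (\<chi> j. cis (real (r j) * x)) \<partial>circle_angle)"
  unfolding power_curve_def by (subst integral_distr) auto

lemma torus_integral_eq_haar:
  assumes "f \<in> borel_measurable borel"
  shows "torus_integral f = (\<integral>z. f z \<partial>torus_haar)"
  unfolding torus_integral_def set_lebesgue_integral_def integral_torus_haar[OF assms] by simp

text \<open>By de Moivre the substitution moves from the integrand to the measure. From here on the
  integrand is fixed and only \<open>power_curve r\<close> varies.\<close>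

lemma torus_integral_eq_power_curve:
  fixes f :: "complex ^ ('n::finite) \<Rightarrow> real"
  assumes [measurable]: "f \<in> borel_measurable borel"
  shows "torus_integral (\<lambda>z :: complex ^ 1. f (\<chi> j. (z $ 1) ^ r j)) = (\<integral>z. f z \<partial>power_curve r)"
proof -
  let ?h = "\<lambda>x::real. indicator {0..2 * pi} x *\<^sub>R f (\<chi> j. cis (real (r j) * x))"
  have ind: "indicator (cbox 0 (\<chi> j. 2 * pi)) \<theta> = (indicator {0..2 * pi} (\<theta> $ 1) :: real)" for \<theta> :: "real ^ 1"
    by (auto simp: indicator_def mem_box_cart forall_1)
  have "torus_integral (\<lambda>z :: complex ^ 1. f (\<chi> j. (z $ 1) ^ r j)) = 1 / (2 * pi) * (\<integral>\<theta>. ?h (\<theta> $ 1) \<partial>(lborel :: (real ^ 1) measure))"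
    unfolding torus_integral_def set_lebesgue_integral_def ind by (simp add: Complex.DeMoivre)
  also have "(\<integral>\<theta>. ?h (\<theta> $ 1) \<partial>(lborel :: (real ^ 1) measure)) = (\<integral>x. ?h x \<partial>distr (lborel :: (real ^ 1) measure) lborel (\<lambda>\<theta>. \<theta> $ 1))"
    by (subst integral_distr) (auto intro!: borel_measurable_continuous_onI continuous_intros)
  also have "1 / (2 * pi) * \<dots> = (\<integral>z. f z \<partial>power_curve r)"
    unfolding distr_lborel_vec1 integral_power_curve[OF assms] by (subst integral_circle_angle) auto
  finally show ?thesis .
qed

section \<open>Equidistribution of power curves\<close>

text \<open>Trigonometric polynomials: on the torus \<open>cnj (z $ j)\<close> is the inverse of
  \<open>z $ j\<close>. Conjugates instead of negative exponents keep the functions continuous on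
  the whole space.\<close>

inductive torus_poly :: "(complex ^ ('n::finite) \<Rightarrow> complex) \<Rightarrow> bool" where
  monomial: "torus_poly (\<lambda>z. c * (\<Prod>j\<in>UNIV. (z $ j) ^ a j * cnj (z $ j) ^ b j))"
| add: "torus_poly f \<Longrightarrow> torus_poly g \<Longrightarrow> torus_poly (\<lambda>z. f z + g z)"

lemma torus_poly_const: "torus_poly (\<lambda>z. c)"
  using torus_poly.monomial[of c "\<lambda>_. 0" "\<lambda>_. 0"] by simp

lemma torus_poly_monomial_mult:
  assumes "torus_poly f"
  shows "torus_poly (\<lambda>z. (c * (\<Prod>j\<in>UNIV. (z $ j) ^ a j * cnj (z $ j) ^ b j)) * f z)"
  using assms
proof induction
  case (monomial c' a' b')
  have "(\<lambda>z. (c * (\<Prod>j\<in>UNIV. (z $ j) ^ a j * cnj (z $ j) ^ b j)) *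
        (c' * (\<Prod>j\<in>UNIV. (z $ j) ^ a' j * cnj (z $ j) ^ b' j))) =
      (\<lambda>z :: complex ^ 'a. (c * c') * (\<Prod>j\<in>UNIV. (z $ j) ^ (a j + a' j) * cnj (z $ j) ^ (b j + b' j)))"
    by (simp add: power_add prod.distrib mult_ac)
  then show ?case by (simp only: torus_poly.monomial)
next
  case (add f g)
  from torus_poly.add[OF add.IH] show ?case unfolding distrib_left .
qed

lemma torus_poly_mult: "torus_poly f \<Longrightarrow> torus_poly g \<Longrightarrow> torus_poly (\<lambda>z. f z * g z)"
proof (induction rule: torus_poly.induct)
  case (monomial c a b)
  then show ?case by (rule torus_poly_monomial_mult)
next
  case (add f f')
  then show ?case by (simp add: distrib_right torus_poly.add)
qed

lemma torus_poly_sum: "finite I \<Longrightarrow> (\<And>i. i \<in> I \<Longrightarrow> torus_poly (f i)) \<Longrightarrow> torus_poly (\<lambda>z. \<Sum>i\<in>I. f i z)"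
  by (induction rule: finite_induct) (auto intro: torus_poly_const torus_poly.add)

lemma torus_poly_component: "torus_poly (\<lambda>z. z $ k)" "torus_poly (\<lambda>z. cnj (z $ k))"
proof -
  have if_power: "w ^ (if P then 1 else 0) = (if P then w else 1)" for w :: complex and P by simp
  show "torus_poly (\<lambda>z. z $ k)"
    using torus_poly.monomial[of 1 "\<lambda>j. if j = k then 1 else 0" "\<lambda>_. 0"]
    unfolding if_power by (simp add: prod.delta)
  show "torus_poly (\<lambda>z. cnj (z $ k))"
    using torus_poly.monomial[of 1 "\<lambda>_. 0" "\<lambda>j. if j = k then 1 else 0"]
    unfolding if_power by (simp add: prod.delta)
qed

text \<open>Stone-Weierstrass supplies polynomials in the real coordinates; real and imaginary parts
  are combinations of \<open>z $ k\<close> and its conjugate.\<close>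

lemma torus_poly_inner_Basis:
  assumes "b \<in> Basis"
  shows "torus_poly (\<lambda>z :: complex ^ ('n::finite). complex_of_real (z \<bullet> b))"
proof -
  from assms obtain k u where b: "b = axis k u" and u: "u = 1 \<or> u = \<i>"
    by (auto simp: Basis_vec_def Basis_complex_def)
  from u show ?thesis
  proof
    assume "u = 1"
    then have "(\<lambda>z. complex_of_real (z \<bullet> b)) = (\<lambda>z. 1 / 2 * (z $ k + cnj (z $ k)))"
      by (simp add: b inner_axis complex_add_cnj fun_eq_iff inner_complex_def)
    then show ?thesis
      by (simp only: torus_poly_mult torus_poly_const torus_poly.add torus_poly_component)
  next
    assume "u = \<i>"
    then have "(\<lambda>z. complex_of_real (z \<bullet> b)) = (\<lambda>z. - \<i> / 2 * (z $ k + - 1 * cnj (z $ k)))"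
      by (auto simp: b inner_axis fun_eq_iff inner_complex_def complex_eq_iff)
    then show ?thesis
      by (simp only: torus_poly_mult torus_poly_const torus_poly.add torus_poly_component)
  qed
qed

lemma torus_poly_real_polynomial_function:
  fixes g :: "complex ^ ('n::finite) \<Rightarrow> real"
  assumes "real_polynomial_function g"
  shows "torus_poly (\<lambda>z. complex_of_real (g z))"
  using assms
proof induction
  case (linear f)
  then interpret bounded_linear f .
  have f_eq: "f z = (\<Sum>b\<in>Basis. (z \<bullet> b) * f b)" for z
    by (subst euclidean_representation[of z, symmetric], simp only: sum scaleR real_scaleR_def)
  have "(\<lambda>z. complex_of_real (f z)) = (\<lambda>z. \<Sum>b\<in>Basis. complex_of_real (z \<bullet> b) * complex_of_real (f b))"
    (is "?l = ?r")
  proof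
    show "?l z = ?r z" for z by (subst f_eq) simp
  qed
  moreover have "torus_poly \<dots>"
    by (intro torus_poly_sum torus_poly_mult torus_poly_inner_Basis torus_poly_const) auto
  ultimately show ?case by simp
qed (auto intro: torus_poly_const torus_poly.add torus_poly_mult)

lemma continuous_on_torus_poly: "torus_poly f \<Longrightarrow> continuous_on A f"
  by (induction rule: torus_poly.induct) (auto intro!: continuous_intros)

lemma cis_power_times_cnj: "cis x ^ a * cnj (cis x) ^ b = cis (of_int (int a - int b) * x)"
  by (simp add: Complex.DeMoivre cis_cnj cis_mult algebra_simps)

lemma prod_cis: "(\<Prod>j\<in>A. cis (f j)) = cis (\<Sum>j\<in>A. f j)"
  by (induction A rule: infinite_finite_induct) (auto simp: cis_mult)

text \<open>Along the curve a monomial is one character, of frequency the pairing of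
  \<open>a - b\<close> with \<open>r\<close>. Compared with the torus integral below, the values can
  differ only if \<open>a - b\<close> is a nontrivial relation among the \<open>r j\<close>.\<close>

lemma integral_power_curve_monomial:
  fixes a b :: "'n::finite \<Rightarrow> nat"
  shows "(\<integral>z. c * (\<Prod>j\<in>UNIV. (z $ j) ^ a j * cnj (z $ j) ^ b j) \<partial>power_curve r) =
    (if (\<Sum>j\<in>UNIV. (int (a j) - int (b j)) * int (r j)) = 0 then c else 0)"
proof -
  have "(\<integral>z. c * (\<Prod>j\<in>UNIV. (z $ j) ^ a j * cnj (z $ j) ^ b j) \<partial>power_curve r) =
      (\<integral>x. c * cis (of_int (\<Sum>j\<in>UNIV. (int (a j) - int (b j)) * int (r j)) * x) \<partial>circle_angle)"
    by (subst integral_power_curve)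
       (auto intro!: borel_measurable_continuous_onI continuous_intros
             simp: cis_power_times_cnj prod_cis sum_distrib_left sum_distrib_right mult_ac simp del: cis_cnj of_int_diff)
  also have "\<dots> = c * (if (\<Sum>j\<in>UNIV. (int (a j) - int (b j)) * int (r j)) = 0 then 1 else 0)"
    unfolding integral_cis_circle_angle[symmetric] by simp
  finally show ?thesis by (auto split: if_splits)
qed

text \<open>The integral factors over the coordinates, and each factor is an orthogonality integral
  on the circle.\<close>

lemma integral_torus_haar_monomial:
  fixes a b :: "'n::finite \<Rightarrow> nat"
  shows "(\<integral>z. c * (\<Prod>j\<in>UNIV. (z $ j) ^ a j * cnj (z $ j) ^ b j) \<partial>torus_haar) = (if a = b then c else 0)"
proof -
  define F where "F = (\<lambda>j x. indicator {0..2 * pi} x *\<^sub>R cis (of_int (int (a j) - int (b j)) * x))"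
  have F_int: "integrable lborel (F j)" for j
    unfolding F_def by (intro borel_integrable_compact) (auto intro!: continuous_intros)
  have ind: "indicator (cbox 0 (\<chi> j. 2 * pi)) \<theta> = (\<Prod>j\<in>UNIV. indicator {0..2 * pi} (\<theta> $ j) :: complex)" for \<theta> :: "real ^ 'n"
    by (auto simp: indicator_def mem_box_cart)
  have "(\<integral>z. (\<Prod>j\<in>UNIV. (z $ j) ^ a j * cnj (z $ j) ^ b j) \<partial>(torus_haar :: (complex ^ 'n) measure)) =
      (1 / (2 * pi) ^ CARD('n)) *\<^sub>R (\<integral>\<theta>. (\<Prod>j\<in>UNIV. F j (\<theta> $ j)) \<partial>(lborel :: (real ^ 'n) measure))"
  proof (subst integral_torus_haar)
    have "indicat_real (cbox 0 (\<chi> j. 2 * pi)) \<theta> *\<^sub>R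
        (\<Prod>j\<in>UNIV. (\<chi> j. cis (\<theta> $ j)) $ j ^ a j * cnj ((\<chi> j. cis (\<theta> $ j)) $ j) ^ b j) =
        (\<Prod>j\<in>UNIV. F j (\<theta> $ j))" for \<theta> :: "real ^ 'n"
      unfolding scaleR_conv_of_real of_real_indicator ind F_def prod.distrib[symmetric]
      by (simp add: cis_power_times_cnj del: cis_cnj of_int_diff)
    then show "(1 / (2 * pi) ^ CARD('n)) *\<^sub>R (LBINT \<theta>. indicat_real (cbox 0 (\<chi> j. 2 * pi)) \<theta> *\<^sub>R
        (\<Prod>j\<in>UNIV. (\<chi> j. cis (\<theta> $ j)) $ j ^ a j * cnj ((\<chi> j. cis (\<theta> $ j)) $ j) ^ b j)) =
        (1 / (2 * pi) ^ CARD('n)) *\<^sub>R (\<integral>\<theta>. (\<Prod>j\<in>UNIV. F j (\<theta> $ j)) \<partial>(lborel :: (real ^ 'n) measure))"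
      by simp
  qed (auto intro!: borel_measurable_continuous_onI continuous_intros)
  also have "\<dots> = (\<Prod>j::'n\<in>UNIV. (1 / (2 * pi)) *\<^sub>R (\<integral>x. F j x \<partial>lborel))"
    unfolding integral_lborel_prod_vec[OF F_int] by (simp add: scaleR_conv_of_real prod_dividef)
  also have "\<dots> = (\<Prod>j\<in>UNIV. \<integral>x. cis (of_int (int (a j) - int (b j)) * x) \<partial>circle_angle)"
    unfolding F_def by (subst integral_circle_angle) auto
  also have "\<dots> = (if a = b then 1 else 0)"
    unfolding integral_cis_circle_angle by (auto simp: fun_eq_iff prod_zero_iff)
  finally show ?thesis by simp
qed

text \<open>How a lower bound on q(r) is exploited: for the exponents of a trigonometric monomial,
  and for differences of exponent vectors of one polynomial.\<close>

lemma sum_ne_0_of_q_rel: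
  fixes t :: "'n::finite \<Rightarrow> int"
  assumes "q_rel r \<ge> enat Q" "t \<noteq> (\<lambda>_. 0)" "\<And>j. \<bar>t j\<bar> < int Q"
  shows "(\<Sum>j\<in>UNIV. t j * int (r j)) \<noteq> 0"
proof
  assume "(\<Sum>j\<in>UNIV. t j * int (r j)) = 0"
  then have "q_rel r \<le> enat (nat (Max (range (\<lambda>j. \<bar>t j\<bar>))))"
    unfolding q_rel_def using assms(2) by (intro Inf_lower) auto
  moreover have "Max (range (\<lambda>j. \<bar>t j\<bar>)) < int Q"
    using assms(3) by (subst Max_less_iff) auto
  moreover have "0 \<le> Max (range (\<lambda>j. \<bar>t j\<bar>))"
    by (rule order.trans[OF abs_ge_zero[of "t undefined"] Max_ge]) auto
  ultimately have "q_rel r < enat Q"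
    by (metis enat_ord_simps(2) le_less_trans nat_less_iff)
  with assms(1) show False by simp
qed

lemma integrable_continuous_torus:
  fixes f :: "complex ^ ('n::finite) \<Rightarrow> 'a::{banach, second_countable_topology}"
  assumes "continuous_on UNIV f"
  shows "integrable torus_haar f" "integrable (power_curve r) f"
proof -
  have "compact (f ` torus)"
    using assms compact_torus by (intro compact_continuous_image) (auto intro: continuous_on_subset)
  then obtain B where B: "\<And>z. z \<in> torus \<Longrightarrow> norm (f z) \<le> B"
    by (meson bounded_iff compact_imp_bounded imageI)
  have [measurable]: "f \<in> borel_measurable borel"
    using assms by (rule borel_measurable_continuous_onI)
  interpret H: prob_space "torus_haar :: (complex ^ 'n) measure" by (rule prob_space_torus_haar)
  interpret C: prob_space "power_curve r" by (rule prob_space_power_curve)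
  show "integrable torus_haar f"
    by (rule H.integrable_const_bound[where B=B]) (use AE_torus_haar in \<open>auto elim!: eventually_mono simp: B\<close>)
  show "integrable (power_curve r) f"
    by (rule C.integrable_const_bound[where B=B]) (use AE_power_curve[of r] in \<open>auto elim!: eventually_mono simp: B\<close>)
qed

lemma torus_poly_equidistribution:
  fixes f :: "complex ^ ('n::finite) \<Rightarrow> complex"
  assumes "torus_poly f"
  shows "\<exists>Q. \<forall>r. q_rel r \<ge> enat Q \<longrightarrow> (\<integral>z. f z \<partial>power_curve r) = (\<integral>z. f z \<partial>torus_haar)"
  using assms
proof induction
  case (monomial c a b)
  define t where "t = (\<lambda>j. int (a j) - int (b j))"
  \<comment> \<open>The \<open>+ 1\<close> gives the strict inequality that excludes
    \<open>t\<close> as a relation.\<close>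
  define Q where "Q = nat (Max (range (\<lambda>j. \<bar>t j\<bar>))) + 1"
  have t_less: "\<bar>t j\<bar> < int Q" for j
  proof -
    have "\<bar>t j\<bar> \<le> Max (range (\<lambda>j. \<bar>t j\<bar>))" by (rule Max_ge) auto
    then show ?thesis unfolding Q_def by linarith
  qed
  have ne0: "(\<Sum>j\<in>UNIV. t j * int (r j)) \<noteq> 0" if "q_rel r \<ge> enat Q" "t \<noteq> (\<lambda>_. 0)" for r
    using that t_less by (rule sum_ne_0_of_q_rel)
  have "t = (\<lambda>_. 0) \<longleftrightarrow> a = b" by (auto simp: t_def fun_eq_iff)
  then show ?case
    unfolding integral_power_curve_monomial integral_torus_haar_monomial
    using ne0 by (intro exI[of _ Q]) (auto simp: t_def)
next
  case (add f g)
  then obtain Q1 Q2 where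
    "\<And>r. q_rel r \<ge> enat Q1 \<Longrightarrow> (\<integral>z. f z \<partial>power_curve r) = (\<integral>z. f z \<partial>torus_haar)"
    "\<And>r. q_rel r \<ge> enat Q2 \<Longrightarrow> (\<integral>z. g z \<partial>power_curve r) = (\<integral>z. g z \<partial>torus_haar)"
    by blast
  moreover have "enat Q1 \<le> q" "enat Q2 \<le> q" if "enat (max Q1 Q2) \<le> q" for q
    using that by (auto intro: order.trans[rotated])
  ultimately show ?case
    using integrable_continuous_torus[OF continuous_on_torus_poly[OF add.hyps(1)]]
      integrable_continuous_torus[OF continuous_on_torus_poly[OF add.hyps(2)]]
    by (intro exI[of _ "max Q1 Q2"]) simp
qed

theorem torus_equidistribution:
  fixes f :: "complex ^ ('n::finite) \<Rightarrow> real"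
  assumes f: "continuous_on UNIV f"
  shows "q_limit (\<lambda>r. \<integral>z. f z \<partial>power_curve r) (\<integral>z. f z \<partial>torus_haar)"
  unfolding q_limit_def
proof (intro allI impI)
  fix \<epsilon> :: real assume \<epsilon>: "0 < \<epsilon>"
  obtain g where g: "real_polynomial_function g" "\<And>z. z \<in> torus \<Longrightarrow> \<bar>f z - g z\<bar> < \<epsilon> / 3"
    using Stone_Weierstrass_real_polynomial_function[OF compact_torus continuous_on_subset[OF f] , of "\<epsilon> / 3"] \<epsilon>
    by auto
  have g_cont: "continuous_on UNIV g"
    using g(1) by (simp add: continuous_on_polymonial_function real_polynomial_function_eq)
  obtain Q where "\<And>r. q_rel r \<ge> enat Q \<Longrightarrow>
      (\<integral>z. complex_of_real (g z) \<partial>power_curve r) = (\<integral>z. complex_of_real (g z) \<partial>torus_haar)"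
    using torus_poly_equidistribution[OF torus_poly_real_polynomial_function[OF g(1)]] by blast
  then have Q: "(\<integral>z. g z \<partial>power_curve r) = (\<integral>z. g z \<partial>torus_haar)" if "q_rel r \<ge> enat Q" for r
    using that by simp
  \<comment> \<open>Approximation is available only on the torus, which carries both measures. It is
    used on each side of the exact equality for \<open>g\<close>, for a total error of at most 2/3
    of \<open>\<epsilon>\<close>.\<close>
  have close: "\<bar>(\<integral>z. f z \<partial>M) - (\<integral>z. g z \<partial>M)\<bar> \<le> \<epsilon> / 3"
    if "prob_space M" "integrable M f" "integrable M g" "AE z in M. z \<in> torus" for M
  proof -
    interpret prob_space M by fact
    have "\<bar>(\<integral>z. f z \<partial>M) - (\<integral>z. g z \<partial>M)\<bar> = \<bar>\<integral>z. f z - g z \<partial>M\<bar>" using that by simp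
    also have "\<dots> \<le> (\<integral>z. \<epsilon> / 3 \<partial>M)"
      by (rule integral_abs_bound[THEN order.trans], rule integral_mono_AE)
         (use that g(2) in \<open>auto elim!: eventually_mono intro: less_imp_le\<close>)
    finally show ?thesis by (simp add: prob_space)
  qed
  show "\<exists>Q. \<forall>r. (\<forall>j. 0 < r j) \<and> enat Q \<le> q_rel r \<longrightarrow> \<bar>(\<integral>z. f z \<partial>power_curve r) - (\<integral>z. f z \<partial>torus_haar)\<bar> < \<epsilon>"
  proof (intro exI[of _ Q] allI impI)
    fix r :: "'n \<Rightarrow> nat" assume "(\<forall>j. 0 < r j) \<and> enat Q \<le> q_rel r"
    then have "(\<integral>z. g z \<partial>power_curve r) = (\<integral>z. g z \<partial>torus_haar)" using Q by simp
    moreover have "\<bar>(\<integral>z. f z \<partial>power_curve r) - (\<integral>z. g z \<partial>power_curve r)\<bar> \<le> \<epsilon> / 3"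
      by (intro close prob_space_power_curve integrable_continuous_torus f g_cont AE_power_curve)
    moreover have "\<bar>(\<integral>z. f z \<partial>torus_haar) - (\<integral>z. g z \<partial>torus_haar)\<bar> \<le> \<epsilon> / 3"
      by (intro close prob_space_torus_haar integrable_continuous_torus f g_cont AE_torus_haar)
    ultimately show "\<bar>(\<integral>z. f z \<partial>power_curve r) - (\<integral>z. f z \<partial>torus_haar)\<bar> < \<epsilon>"
      using \<epsilon> by linarith
  qed
qed

section \<open>Small values of polynomials on the torus\<close>

text \<open>For \<open>r j = N ^ idx j\<close> a relation \<open>t\<close> says that
  \<open>N\<close> is a root of the polynomial with coefficients \<open>t j\<close>. Only finitely
  many \<open>t\<close> have entries bounded by \<open>Q\<close>, each with finitely many roots, so
  some positive \<open>N\<close> avoids them all.\<close>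

lemma exists_large_q_rel: "\<exists>r :: 'n::finite \<Rightarrow> nat. (\<forall>j. 0 < r j) \<and> q_rel r \<ge> enat Q"
proof -
  obtain idx :: "'n \<Rightarrow> nat" where idx: "inj idx"
    using finite_imp_inj_to_nat_seg[of "UNIV :: 'n set"] by auto
  define p :: "('n \<Rightarrow> int) \<Rightarrow> int poly" where "p t = (\<Sum>j\<in>UNIV. monom (t j) (idx j))" for t
  have coeff_p: "coeff (p t) (idx j) = t j" for t j
  proof -
    have "coeff (p t) (idx j) = (\<Sum>i\<in>UNIV. if i = j then t i else 0)"
      unfolding p_def coeff_sum using idx by (intro sum.cong) (auto dest: injD)
    then show ?thesis by simp
  qed
  define T where "T = {t :: 'n \<Rightarrow> int. t \<noteq> (\<lambda>_. 0) \<and> (\<forall>j. \<bar>t j\<bar> \<le> int Q)}"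
  have "T \<subseteq> (\<Pi>\<^sub>E j\<in>UNIV. {- int Q..int Q})" by (auto simp: T_def PiE_def abs_le_iff) (metis abs_le_iff minus_le_iff)
  then have "finite T" by (rule finite_subset) (intro finite_PiE; simp)
  have "finite {x. poly (p t) x = 0}" if "t \<in> T" for t
  proof (rule poly_roots_finite)
    from that obtain j where "t j \<noteq> 0" by (auto simp: T_def fun_eq_iff)
    then show "p t \<noteq> 0" using coeff_p[of t j] by auto
  qed
  then have fin: "finite (\<Union>t\<in>T. {x. poly (p t) x = 0})" using \<open>finite T\<close> by blast
  have "inj_on int {1..}" by simp
  then have "infinite (int ` {1..})" using finite_imageD infinite_Ici by blast
  then have "infinite (int ` {1..} - (\<Union>t\<in>T. {x. poly (p t) x = 0}))"
    using fin by (rule Diff_infinite_finite[rotated])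
  then have "int ` {1..} - (\<Union>t\<in>T. {x. poly (p t) x = 0}) \<noteq> {}" by (rule infinite_imp_nonempty)
  then obtain N where N: "1 \<le> N" "int N \<notin> (\<Union>t\<in>T. {x. poly (p t) x = 0})" by blast
  define r where "r = (\<lambda>j. N ^ idx j)"
  have "enat Q \<le> q_rel r"
    unfolding q_rel_def
  proof (rule Inf_greatest)
    fix x assume "x \<in> {enat (nat (Max (range (\<lambda>j. \<bar>t j\<bar>)))) | t :: 'n \<Rightarrow> int.
                    t \<noteq> (\<lambda>_. 0) \<and> (\<Sum>j\<in>UNIV. t j * int (r j)) = 0}"
    then obtain t :: "'n \<Rightarrow> int" where t: "x = enat (nat (Max (range (\<lambda>j. \<bar>t j\<bar>))))" "t \<noteq> (\<lambda>_. 0)"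
      "(\<Sum>j\<in>UNIV. t j * int (r j)) = 0" by auto
    have "poly (p t) (int N) = 0"
      using t(3) by (simp add: p_def poly_sum poly_monom r_def)
    then have "t \<notin> T" using N by auto
    then obtain j where j: "int Q < \<bar>t j\<bar>" using t(2) by (auto simp: T_def not_le)
    have "\<bar>t j\<bar> \<le> Max (range (\<lambda>j. \<bar>t j\<bar>))" by (rule Max_ge) auto
    with j have "Q \<le> nat (Max (range (\<lambda>j. \<bar>t j\<bar>)))" by linarith
    then show "enat Q \<le> x" by (simp add: t(1))
  qed
  moreover have "\<forall>j. 0 < r j" using N by (simp add: r_def)
  ultimately show ?thesis by blast
qed

lemma continuous_on_cpoly_eval [continuous_intros]: "continuous_on A (cpoly_eval P)"
  unfolding cpoly_eval_def by (intro continuous_intros)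

lemma borel_measurable_cpoly_eval [measurable]: "cpoly_eval P \<in> borel_measurable borel"
  by (intro borel_measurable_continuous_onI continuous_intros)

lemma cpoly_eval_curve:
  "cpoly_eval P (\<chi> j. cis (real (r j) * x)) = (\<Sum>l\<in>Poly_Mapping.keys P.
     Poly_Mapping.lookup P l * cis (of_int (\<Sum>j\<in>UNIV. int (Poly_Mapping.lookup l j) * int (r j)) * x))"
  unfolding cpoly_eval_def
  by (intro sum.cong refl) (simp add: Complex.DeMoivre prod_cis sum_distrib_left sum_distrib_right mult_ac)

text \<open>Once \<open>Q\<close> exceeds all exponents in \<open>P\<close>, different monomials
  have different frequencies along the curve. The bound for exponential sums then applies with the
  same number of terms and the same coefficient for every such \<open>r\<close>.\<close>

lemma measure_power_curve_small:
  fixes P :: "('n::finite) cpoly"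
  assumes "P \<noteq> 0"
  shows "\<exists>C \<delta> Q. 0 \<le> C \<and> 0 < \<delta> \<and> (\<forall>r y. q_rel r \<ge> enat Q \<longrightarrow> 0 < y \<longrightarrow>
     measure (power_curve r) {z. norm (cpoly_eval P z) \<le> y} \<le> C * y powr \<delta>)"
proof -
  obtain m where m: "m \<in> Poly_Mapping.keys P" using assms by (meson ex_in_conv keys_eq_empty)
  define B where "B = Poly_Mapping.keys P - {m}"
  have B: "finite B" "m \<notin> B" "insert m B = Poly_Mapping.keys P" using m by (auto simp: B_def)
  define c where "c = Poly_Mapping.lookup P m"
  have c: "c \<noteq> 0" using m by (simp add: c_def in_keys_iff)
  obtain C \<delta> where H: "1 \<le> C \<and> 0 < \<delta> \<and> \<delta> \<le> (1::real) \<and>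
     (\<forall>(A::('n \<Rightarrow>\<^sub>0 nat) set) m (a::('n \<Rightarrow>\<^sub>0 nat) \<Rightarrow> complex) (n::('n \<Rightarrow>\<^sub>0 nat) \<Rightarrow> int) y.
        finite A \<longrightarrow> card A = card B \<longrightarrow> m \<notin> A \<longrightarrow> (\<forall>k\<in>A. n k \<noteq> n m) \<longrightarrow> a m \<noteq> 0 \<longrightarrow> 0 < y \<longrightarrow>
        measure circle_angle {x. norm (\<Sum>l\<in>insert m A. a l * cis (of_int (n l) * x)) \<le> y}
          \<le> C * (y / norm (a m)) powr \<delta>)"
    using measure_small_exponential_sum[of "card B"] by (elim exE) (rule that)
  note small = H[THEN conjunct2, THEN conjunct2, THEN conjunct2, rule_format]
  define Q where "Q = Suc (\<Sum>l\<in>Poly_Mapping.keys P. \<Sum>j\<in>UNIV. Poly_Mapping.lookup l j)"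
  have less_Q: "Poly_Mapping.lookup l j < Q" if "l \<in> Poly_Mapping.keys P" for l j
  proof -
    have "Poly_Mapping.lookup l j \<le> (\<Sum>j\<in>UNIV. Poly_Mapping.lookup l j)" by (rule member_le_sum) auto
    also have "\<dots> \<le> (\<Sum>l\<in>Poly_Mapping.keys P. \<Sum>j\<in>UNIV. Poly_Mapping.lookup l j)"
      using that by (intro member_le_sum) auto
    finally show ?thesis by (simp add: Q_def)
  qed
  show ?thesis
  \<comment> \<open>The marked coefficient does not depend on \<open>r\<close> and is moved into the
    constant.\<close>
  proof (rule exI[of _ "C * (1 / norm c) powr \<delta>"], rule exI[of _ \<delta>], rule exI[of _ Q], intro conjI allI impI)
    fix r :: "'n \<Rightarrow> nat" and y :: real
    assume r: "enat Q \<le> q_rel r" and y: "0 < y"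
    define n where "n = (\<lambda>l :: 'n \<Rightarrow>\<^sub>0 nat. \<Sum>j\<in>UNIV. int (Poly_Mapping.lookup l j) * int (r j))"
    have n: "n k \<noteq> n m" if k: "k \<in> B" for k
    proof -
      define t where "t = (\<lambda>j. int (Poly_Mapping.lookup k j) - int (Poly_Mapping.lookup m j))"
      have "k \<noteq> m" "k \<in> Poly_Mapping.keys P" using k by (auto simp: B_def)
      then have "t \<noteq> (\<lambda>_. 0)" by (auto simp: t_def fun_eq_iff poly_mapping_eq_iff)
      moreover have "\<bar>t j\<bar> < int Q" for j
        using less_Q[OF m, of j] less_Q[OF \<open>k \<in> Poly_Mapping.keys P\<close>, of j] by (simp add: t_def)
      ultimately have "(\<Sum>j\<in>UNIV. t j * int (r j)) \<noteq> 0" using r by (intro sum_ne_0_of_q_rel)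
      then show ?thesis by (simp add: t_def n_def left_diff_distrib sum_subtractf)
    qed
    have "measure (power_curve r) {z. norm (cpoly_eval P z) \<le> y} =
        measure circle_angle {x. norm (\<Sum>l\<in>insert m B. Poly_Mapping.lookup P l * cis (of_int (n l) * x)) \<le> y}"
      unfolding power_curve_def B(3)
      by (subst measure_distr) (auto simp: vimage_def cpoly_eval_curve n_def)
    also have "\<dots> \<le> C * (y / norm c) powr \<delta>"
      unfolding c_def using B n y c by (intro small) (auto simp: c_def)
    also have "\<dots> = C * (1 / norm c) powr \<delta> * y powr \<delta>"
      using y by (simp add: powr_divide)
    finally show "measure (power_curve r) {z. norm (cpoly_eval P z) \<le> y} \<le> C * (1 / norm c) powr \<delta> * y powr \<delta>" .
  qed (use H in auto)
qed

text \<open>One pair of constants for the torus and the curves. The torus bound is a limit of curve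
  bounds: for each error \<open>\<epsilon>\<close> one sufficiently equidistributed curve is enough,
  since \<open>C\<close> and \<open>\<delta>\<close> do not depend on it.\<close>

lemma measure_torus_small:
  fixes P :: "('n::finite) cpoly"
  assumes "P \<noteq> 0"
  shows "\<exists>C \<delta> Q. 0 \<le> C \<and> 0 < \<delta> \<and>
    (\<forall>y>0. measure torus_haar {z. norm (cpoly_eval P z) \<le> y} \<le> C * y powr \<delta>) \<and>
    (\<forall>r. q_rel r \<ge> enat Q \<longrightarrow> (\<forall>y>0. measure (power_curve r) {z. norm (cpoly_eval P z) \<le> y} \<le> C * y powr \<delta>))"
proof -
  obtain C \<delta> Q where C: "0 \<le> C" and \<delta>: "0 < \<delta>" and curve: "\<And>r y. q_rel r \<ge> enat Q \<Longrightarrow> 0 < y \<Longrightarrow>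
     measure (power_curve r) {z. norm (cpoly_eval P z) \<le> y} \<le> C * y powr \<delta>"
    using measure_power_curve_small[OF assms] by blast
  have haar: "measure torus_haar {z. norm (cpoly_eval P z) \<le> y} \<le> C * 2 powr \<delta> * y powr \<delta>" if y: "0 < y" for y
  proof (rule field_le_epsilon)
    fix \<epsilon> :: real assume \<epsilon>: "0 < \<epsilon>"
    \<comment> \<open>A continuous function between the indicators of the sublevel sets at
      \<open>y\<close> and at \<open>2 * y\<close>; the doubled level accounts for the factor
      \<open>2 powr \<delta>\<close>.\<close>
    define f where "f = (\<lambda>z. max 0 (min 1 (2 - norm (cpoly_eval P z) / y)))"
    have f: "continuous_on UNIV f" unfolding f_def using y by (intro continuous_intros) auto
    interpret H: prob_space "torus_haar :: (complex ^ 'n) measure" by (rule prob_space_torus_haar)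
    obtain Q' where Q': "\<And>r. (\<forall>j. 0 < r j) \<and> enat Q' \<le> q_rel r \<Longrightarrow>
        \<bar>(\<integral>z. f z \<partial>power_curve r) - (\<integral>z. f z \<partial>torus_haar)\<bar> < \<epsilon>"
      using torus_equidistribution[OF f] \<epsilon> unfolding q_limit_def by blast
    obtain r :: "'n \<Rightarrow> nat" where r: "\<forall>j. 0 < r j" "enat (max Q Q') \<le> q_rel r"
      using exists_large_q_rel by blast
    then have "enat Q \<le> q_rel r" "enat Q' \<le> q_rel r" by (auto intro: order.trans[rotated])
    interpret C: prob_space "power_curve r" by (rule prob_space_power_curve)
    have "measure torus_haar {z. norm (cpoly_eval P z) \<le> y} = (\<integral>z. indicator {z. norm (cpoly_eval P z) \<le> y} z \<partial>torus_haar)"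
      by simp
    also have "\<dots> \<le> (\<integral>z. f z \<partial>torus_haar)"
    proof (rule integral_mono)
      show "indicator {z. norm (cpoly_eval P z) \<le> y} z \<le> f z" for z
        using y by (auto simp: f_def indicator_def field_simps)
    qed (use integrable_continuous_torus[OF f] in \<open>auto simp: H.emeasure_eq_measure\<close>)
    also have "\<dots> \<le> (\<integral>z. f z \<partial>power_curve r) + \<epsilon>"
      using Q'[of r] r \<open>enat Q' \<le> q_rel r\<close> by auto
    also have "(\<integral>z. f z \<partial>power_curve r) \<le> (\<integral>z. indicator {z. norm (cpoly_eval P z) \<le> 2 * y} z \<partial>power_curve r)"
    proof (rule integral_mono)
      show "f z \<le> indicator {z. norm (cpoly_eval P z) \<le> 2 * y} z" for z
        using y by (auto simp: f_def indicator_def field_simps)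
    qed (use integrable_continuous_torus[OF f] in \<open>auto simp: C.emeasure_eq_measure\<close>)
    also have "\<dots> = measure (power_curve r) {z. norm (cpoly_eval P z) \<le> 2 * y}" by simp
    also have "\<dots> \<le> C * (2 * y) powr \<delta>"
      using y by (intro curve \<open>enat Q \<le> q_rel r\<close>) auto
    finally show "measure torus_haar {z. norm (cpoly_eval P z) \<le> y} \<le> C * 2 powr \<delta> * y powr \<delta> + \<epsilon>"
      using y by (simp add: powr_mult mult.assoc)
  qed
  have curve': "measure (power_curve r) {z. norm (cpoly_eval P z) \<le> y} \<le> C * 2 powr \<delta> * y powr \<delta>"
    if "q_rel r \<ge> enat Q" "0 < y" for r y
  proof -
    have "1 \<le> 2 powr \<delta>" using \<delta> by (simp add: ge_one_powr_ge_zero)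
    then have "C * 1 * y powr \<delta> \<le> C * 2 powr \<delta> * y powr \<delta>"
      using C by (intro mult_right_mono mult_left_mono) auto
    then show ?thesis using curve[OF that] by simp
  qed
  show ?thesis
    by (rule exI[of _ "C * 2 powr \<delta>"], rule exI[of _ \<delta>], rule exI[of _ Q])
       (use haar curve' C \<delta> in auto)
qed

section \<open>The limit theorem\<close>

lemma norm_cpoly_eval_torus_le:
  assumes "z \<in> torus"
  shows "norm (cpoly_eval P z) \<le> (\<Sum>m\<in>Poly_Mapping.keys P. norm (Poly_Mapping.lookup P m))"
  unfolding cpoly_eval_def
  by (rule order.trans[OF norm_sum], rule sum_mono)
     (use assms in \<open>simp add: norm_mult norm_power torus_def flip: prod_norm\<close>)

text \<open>\<open>g\<close> will be the maximum or the product of the first \<open>s\<close>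
  entries. \<open>bound\<close> controls the singularities, while \<open>cont\<close> makes the
  truncated integrand accessible to equidistribution.\<close>

lemma q_limit_log_functional:
  fixes P :: "nat \<Rightarrow> ('n::finite) cpoly" and g :: "(nat \<Rightarrow> real) \<Rightarrow> real"
  assumes s: "1 \<le> s" and P: "\<And>i. i \<in> {1..s} \<Longrightarrow> P i \<noteq> 0"
    and bound: "\<And>u L. (\<And>i. i \<in> {1..s} \<Longrightarrow> \<bar>u i\<bar> \<le> L) \<Longrightarrow> \<bar>g u\<bar> \<le> (1 + L) ^ s"
    and cong: "\<And>u v. (\<And>i. i \<in> {1..s} \<Longrightarrow> u i = v i) \<Longrightarrow> g u = g v"
    and cont: "\<And>u :: nat \<Rightarrow> complex ^ 'n \<Rightarrow> real. (\<And>i. continuous_on UNIV (u i)) \<Longrightarrow> continuous_on UNIV (\<lambda>z. g (\<lambda>i. u i z))"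
    and meas: "\<And>u :: nat \<Rightarrow> complex ^ 'n \<Rightarrow> real. (\<And>i. u i \<in> borel_measurable borel) \<Longrightarrow> (\<lambda>z. g (\<lambda>i. u i z)) \<in> borel_measurable borel"
  shows "q_limit (\<lambda>r. torus_integral (\<lambda>z. g (\<lambda>i. ln (norm (cpoly_eval (power_subst r (P i)) z)))))
           (torus_integral (\<lambda>z. g (\<lambda>i. ln (norm (cpoly_eval (P i) z)))))"
proof -
  define F where "F = (\<lambda>z. g (\<lambda>i. ln (norm (cpoly_eval (P i) z))))"
  define T where "T = (\<lambda>y z. g (\<lambda>i. trunc_ln y (cpoly_eval (P i) z)))"
  have F_meas: "F \<in> borel_measurable borel" unfolding F_def by (intro meas) simp
  have T_cont: "continuous_on UNIV (T y)" if "0 < y" for y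
    unfolding T_def trunc_ln_def using that
    by (intro cont continuous_intros) (auto simp: max_def)
  have T_meas: "T y \<in> borel_measurable borel" if "0 < y" for y
    by (rule borel_measurable_continuous_onI) (rule T_cont[OF that])

  have "\<forall>i\<in>{1..s}. \<exists>C \<delta> Q. 0 \<le> C \<and> 0 < \<delta> \<and>
    (\<forall>y>0. measure torus_haar {z. norm (cpoly_eval (P i) z) \<le> y} \<le> C * y powr \<delta>) \<and>
    (\<forall>r. q_rel r \<ge> enat Q \<longrightarrow> (\<forall>y>0. measure (power_curve r) {z. norm (cpoly_eval (P i) z) \<le> y} \<le> C * y powr \<delta>))"
    using measure_torus_small P by blast
  then obtain C \<delta> Q where
    C: "\<And>i. i \<in> {1..s} \<Longrightarrow> 0 \<le> C i" and \<delta>: "\<And>i. i \<in> {1..s} \<Longrightarrow> 0 < \<delta> i" and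
    haar: "\<And>i y. i \<in> {1..s} \<Longrightarrow> 0 < y \<Longrightarrow> measure torus_haar {z. norm (cpoly_eval (P i) z) \<le> y} \<le> C i * y powr \<delta> i" and
    curve: "\<And>i r y. i \<in> {1..s} \<Longrightarrow> q_rel r \<ge> enat (Q i) \<Longrightarrow> 0 < y \<Longrightarrow>
       measure (power_curve r) {z. norm (cpoly_eval (P i) z) \<le> y} \<le> C i * y powr \<delta> i"
    unfolding bchoice_iff by blast
  \<comment> \<open>\<open>trunc_ln_integral\<close> wants one constant and one exponent for all
    \<open>i\<close>. The summand 1 gives \<open>C0 \<ge> 1\<close>.\<close>
  define C0 where "C0 = 1 + (\<Sum>i=1..s. C i)"
  define \<delta>0 where "\<delta>0 = Min (\<delta> ` {1..s})"
  define Q0 where "Q0 = (\<Sum>i=1..s. Q i)"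
  define B where "B = 1 + (\<Sum>i=1..s. \<Sum>m\<in>Poly_Mapping.keys (P i). norm (Poly_Mapping.lookup (P i) m))"
  have C0: "1 \<le> C0" using C by (auto simp: C0_def intro!: sum_nonneg)
  have \<delta>0: "0 < \<delta>0" unfolding \<delta>0_def using s \<delta> by (subst Min_gr_iff) auto
  have Q0: "q_rel r \<ge> enat (Q i)" if "i \<in> {1..s}" "q_rel r \<ge> enat Q0" for i r
  proof -
    have "Q i \<le> Q0" unfolding Q0_def using that by (intro member_le_sum) auto
    then show ?thesis using that(2) by (meson enat_ord_simps(1) order.trans)
  qed
  have B: "1 \<le> B" by (auto simp: B_def intro!: sum_nonneg)
  have B_bound: "norm (cpoly_eval (P i) z) \<le> B" if "i \<in> {1..s}" "z \<in> torus" for i z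
  proof -
    have "norm (cpoly_eval (P i) z) \<le> (\<Sum>m\<in>Poly_Mapping.keys (P i). norm (Poly_Mapping.lookup (P i) m))"
      using that by (intro norm_cpoly_eval_torus_le)
    also have "\<dots> \<le> (\<Sum>i=1..s. \<Sum>m\<in>Poly_Mapping.keys (P i). norm (Poly_Mapping.lookup (P i) m))"
      using that by (intro member_le_sum[of i "{1..s}"]) (auto intro: sum_nonneg)
    finally show ?thesis by (simp add: B_def)
  qed
  \<comment> \<open>Lowering the exponent weakens the bound only for \<open>y \<le> 1\<close>; for
    larger \<open>y\<close> the new bound is at least 1, which suffices for a probability.\<close>
  have uniform: "a \<le> C0 * y powr \<delta>0" if "a \<le> C i * y powr \<delta> i" "a \<le> 1" "i \<in> {1..s}" "0 < y" for a y i
  proof (cases "y \<le> 1")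
    case True
    have "C i \<le> (\<Sum>i=1..s. C i)" using that C by (intro member_le_sum) auto
    then have "C i \<le> C0" by (simp add: C0_def)
    moreover have "y powr \<delta> i \<le> y powr \<delta>0"
      using that True by (intro powr_mono') (auto simp: \<delta>0_def)
    ultimately have "C i * y powr \<delta> i \<le> C0 * y powr \<delta>0"
      using C0 by (intro mult_mono) auto
    with that show ?thesis by simp
  next
    case False
    then have "1 * 1 \<le> C0 * y powr \<delta>0"
      using C0 \<delta>0 by (intro mult_mono ge_one_powr_ge_zero) auto
    with that show ?thesis by simp
  qed
  from C0 have "0 \<le> C0" by simp
  obtain K \<eta> where \<eta>: "0 < \<eta>" and trunc:
    "\<And>M (p :: nat \<Rightarrow> complex ^ 'n \<Rightarrow> complex) y. \<lbrakk>prob_space M; \<And>i. i \<in> {1..s} \<Longrightarrow> p i \<in> borel_measurable M;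
       (\<lambda>x. g (\<lambda>i. ln (norm (p i x)))) \<in> borel_measurable M;
       (\<lambda>x. g (\<lambda>i. trunc_ln y (p i x))) \<in> borel_measurable M;
       \<And>i. i \<in> {1..s} \<Longrightarrow> AE x in M. norm (p i x) \<le> B;
       \<And>i t. i \<in> {1..s} \<Longrightarrow> 0 < t \<Longrightarrow> measure M {x \<in> space M. norm (p i x) \<le> t} \<le> C0 * t powr \<delta>0;
       0 < y; y < 1\<rbrakk> \<Longrightarrow>
       \<bar>(\<integral>x. g (\<lambda>i. ln (norm (p i x))) \<partial>M) - (\<integral>x. g (\<lambda>i. trunc_ln y (p i x)) \<partial>M)\<bar> \<le> K * y powr \<eta>"
    by (rule trunc_ln_integral[OF bound cong s B \<open>0 \<le> C0\<close> \<delta>0, where 'z="complex ^ 'n"]) blast+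
  have trunc_haar: "\<bar>(\<integral>z. F z \<partial>torus_haar) - (\<integral>z. T y z \<partial>torus_haar)\<bar> \<le> K * y powr \<eta>" if y: "0 < y" "y < 1" for y
    unfolding F_def T_def
  proof (rule trunc[OF prob_space_torus_haar])
    interpret prob_space "torus_haar :: (complex ^ 'n) measure" by (rule prob_space_torus_haar)
    show "AE z in torus_haar. norm (cpoly_eval (P i) z) \<le> B" if "i \<in> {1..s}" for i
      using AE_torus_haar by eventually_elim (use B_bound that in auto)
    show "measure torus_haar {z \<in> space torus_haar. norm (cpoly_eval (P i) z) \<le> t} \<le> C0 * t powr \<delta>0"
      if "i \<in> {1..s}" "0 < t" for i t
      using uniform[OF haar[OF that] prob_le_1 that] by simp
  qed (use F_meas T_meas y in \<open>auto simp: F_def T_def\<close>)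
  have trunc_curve: "\<bar>(\<integral>z. F z \<partial>power_curve r) - (\<integral>z. T y z \<partial>power_curve r)\<bar> \<le> K * y powr \<eta>"
    if y: "0 < y" "y < 1" and r: "q_rel r \<ge> enat Q0" for y r
    unfolding F_def T_def
  proof (rule trunc[OF prob_space_power_curve])
    interpret prob_space "power_curve r" by (rule prob_space_power_curve)
    show "AE z in power_curve r. norm (cpoly_eval (P i) z) \<le> B" if "i \<in> {1..s}" for i
      using AE_power_curve by eventually_elim (use B_bound that in auto)
    show "measure (power_curve r) {z \<in> space (power_curve r). norm (cpoly_eval (P i) z) \<le> t} \<le> C0 * t powr \<delta>0"
      if "i \<in> {1..s}" "0 < t" for i t
      using uniform[OF curve[OF that(1) Q0[OF that(1) r] that(2)] prob_le_1 that] by simp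
  qed (use F_meas T_meas y in \<open>auto simp: F_def T_def\<close>)

  have "q_limit (\<lambda>r. \<integral>z. F z \<partial>power_curve r) (\<integral>z. F z \<partial>torus_haar)"
    unfolding q_limit_def
  proof (intro allI impI)
    fix \<epsilon> :: real assume \<epsilon>: "0 < \<epsilon>"
    have "((\<lambda>y. K * y powr \<eta>) \<longlongrightarrow> 0) (at_right 0)"
      using \<eta> by (auto intro!: tendsto_eq_intros simp: eventually_at_filter)
    then have "\<forall>\<^sub>F y in at_right 0. K * y powr \<eta> < \<epsilon> / 3"
      by (rule order_tendstoD(2)) (use \<epsilon> in simp)
    moreover have "\<forall>\<^sub>F y in at_right 0. y \<in> {0<..<1::real}"
      by (rule eventually_at_right_real) simp
    ultimately have "\<forall>\<^sub>F y in at_right 0. K * y powr \<eta> < \<epsilon> / 3 \<and> y \<in> {0<..<1}"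
      by (rule eventually_conj)
    \<comment> \<open>The level \<open>y\<close> is fixed before the threshold \<open>Q'\<close>:
      truncation errors are uniform in \<open>r\<close> beyond \<open>Q0\<close>, whereas the speed
      of equidistribution depends on \<open>T y\<close>.\<close>
    then obtain y where y: "K * y powr \<eta> < \<epsilon> / 3" "0 < y" "y < 1"
      using eventually_happens'[OF trivial_limit_at_right_real] by fastforce
    obtain Q' where Q': "\<And>r. (\<forall>j. 0 < r j) \<and> enat Q' \<le> q_rel r \<Longrightarrow>
        \<bar>(\<integral>z. T y z \<partial>power_curve r) - (\<integral>z. T y z \<partial>torus_haar)\<bar> < \<epsilon> / 3"
      using torus_equidistribution[OF T_cont[OF y(2)]] \<epsilon> unfolding q_limit_def
      by (metis divide_pos_pos zero_less_numeral)
    show "\<exists>Q. \<forall>r. (\<forall>j. 0 < r j) \<and> enat Q \<le> q_rel r \<longrightarrow> \<bar>(\<integral>z. F z \<partial>power_curve r) - (\<integral>z. F z \<partial>torus_haar)\<bar> < \<epsilon>"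
    proof (intro exI[of _ "max Q0 Q'"] allI impI)
      fix r :: "'n \<Rightarrow> nat" assume r: "(\<forall>j. 0 < r j) \<and> enat (max Q0 Q') \<le> q_rel r"
      then have q: "enat Q0 \<le> q_rel r" "enat Q' \<le> q_rel r" by (auto intro: order.trans[rotated])
      have "\<bar>(\<integral>z. T y z \<partial>power_curve r) - (\<integral>z. T y z \<partial>torus_haar)\<bar> < \<epsilon> / 3"
        using Q' r q by blast
      with trunc_curve[OF y(2,3) q(1)] trunc_haar[OF y(2,3)] y(1)
      show "\<bar>(\<integral>z. F z \<partial>power_curve r) - (\<integral>z. F z \<partial>torus_haar)\<bar> < \<epsilon>" by linarith
    qed
  qed
  moreover have "torus_integral (\<lambda>z. g (\<lambda>i. ln (norm (cpoly_eval (P i) z)))) = (\<integral>z. F z \<partial>torus_haar)"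
    unfolding F_def[symmetric] by (rule torus_integral_eq_haar) (rule F_meas)
  moreover have "torus_integral (\<lambda>z. g (\<lambda>i. ln (norm (cpoly_eval (power_subst r (P i)) z)))) = (\<integral>z. F z \<partial>power_curve r)" for r
    using torus_integral_eq_power_curve[OF F_meas, of r] by (simp add: F_def cpoly_eval_power_subst)
  ultimately show ?thesis by simp
qed

lemma continuous_on_Max_image:
  fixes f :: "'i \<Rightarrow> 'a::topological_space \<Rightarrow> real"
  assumes "finite I" "I \<noteq> {}" "\<And>i. i \<in> I \<Longrightarrow> continuous_on A (f i)"
  shows "continuous_on A (\<lambda>x. Max ((\<lambda>i. f i x) ` I))"
  using assms by (induction rule: finite_ne_induct) (auto intro!: continuous_on_max)

theorem theorem1p2:
  fixes P :: "nat \<Rightarrow> ('n::finite) cpoly" and s :: nat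
  assumes "s \<ge> 1"
    and "\<And>i. i \<in> {1..s} \<Longrightarrow> P i \<noteq> 0"
  shows "q_limit (\<lambda>r. mahler_max s (\<lambda>i. power_subst r (P i))) (mahler_max s P) \<and>
         q_limit (\<lambda>r. mahler_multiple s (\<lambda>i. power_subst r (P i))) (mahler_multiple s P) \<and>
         (\<forall>P\<^sub>0. (\<forall>i\<in>{1..s}. P i = P\<^sub>0) \<longrightarrow>
                q_limit (\<lambda>r. mahler_higher s (power_subst r P\<^sub>0)) (mahler_higher s P\<^sub>0))"
proof -
  have max: "q_limit (\<lambda>r. mahler_max s (\<lambda>i. power_subst r (P i))) (mahler_max s P)"
    unfolding mahler_max_def
  proof (rule q_limit_log_functional[where g="\<lambda>u. Max (u ` {1..s})"])
    fix u :: "nat \<Rightarrow> real" and L assume u: "\<And>i. i \<in> {1..s} \<Longrightarrow> \<bar>u i\<bar> \<le> L"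
    have "Max (u ` {1..s}) \<in> u ` {1..s}" using assms(1) by (intro Max_in) auto
    then have "\<bar>Max (u ` {1..s})\<bar> \<le> L" using u by auto
    also have "L \<le> 1 + L" by simp
    \<comment> \<open>\<open>s \<ge> 1\<close> provides \<open>u 1\<close>, hence
      \<open>L \<ge> 0\<close>, so that the base is at least 1.\<close>
    also have "\<dots> \<le> (1 + L) ^ s"
      using assms(1) u[of 1] by (intro self_le_power) auto
    finally show "\<bar>Max (u ` {1..s})\<bar> \<le> (1 + L) ^ s" .
  next
    fix u v :: "nat \<Rightarrow> real" assume "\<And>i. i \<in> {1..s} \<Longrightarrow> u i = v i"
    then show "Max (u ` {1..s}) = Max (v ` {1..s})" by (metis (no_types, lifting) image_cong)
  qed (use assms in \<open>auto intro!: continuous_on_Max_image borel_measurable_Max\<close>)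
  have mult: "q_limit (\<lambda>r. mahler_multiple s (\<lambda>i. power_subst r (P i))) (mahler_multiple s P)"
    unfolding mahler_multiple_def
  proof (rule q_limit_log_functional[where g="\<lambda>u. \<Prod>i=1..s. u i"])
    fix u :: "nat \<Rightarrow> real" and L assume u: "\<And>i. i \<in> {1..s} \<Longrightarrow> \<bar>u i\<bar> \<le> L"
    have "\<bar>\<Prod>i=1..s. u i\<bar> \<le> (\<Prod>i=1..s. 1 + L)"
      unfolding abs_prod using u by (intro prod_mono) fastforce
    then show "\<bar>\<Prod>i=1..s. u i\<bar> \<le> (1 + L) ^ s" by simp
  qed (use assms in \<open>auto intro!: continuous_intros\<close>)
  have "q_limit (\<lambda>r. mahler_higher s (power_subst r P\<^sub>0)) (mahler_higher s P\<^sub>0)" if "\<forall>i\<in>{1..s}. P i = P\<^sub>0" for P\<^sub>0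
  proof -
    \<comment> \<open>With equal polynomials the product of the \<open>s\<close> logarithms is an
      \<open>s\<close>-th power, so the third limit is a case of the second.\<close>
    have "mahler_multiple s (\<lambda>i. power_subst r (P i)) = mahler_higher s (power_subst r P\<^sub>0)" for r
      unfolding mahler_multiple_def mahler_higher_def using that by simp
    moreover have "mahler_multiple s P = mahler_higher s P\<^sub>0"
      unfolding mahler_multiple_def mahler_higher_def using that by simp
    ultimately show ?thesis using mult by simp
  qed
  with max mult show ?thesis by blast
qed

end
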